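(* Let $W$ be the limit law of the normalized writhe $W_{2n+1}=w(\pi)/n$ ($\pi\in S_{2n+1}$ uniformly random, $n\to\infty$). Let $A$ be a random variable with density $f_A(x) = \tfrac{1}{\pi}\,\mathrm{sech}\, x$ on $\mathbb{R}$, and let $A_1,A_2,\dots$ be independent copies of $A$. Then the infinite sum $$\frac{4}{\pi^2} \sum_{n=1}^\infty \frac{1}{n} A_n$$ converges almost surely to a random variable having the same distribution as $W$.
   Context: For a one-to-one function $f:\mathbb{Z}_{2n+1}\to\mathbb{R}$, where $\mathbb{Z}_{2n+1}=\mathbb{Z}/(2n+1)\mathbb{Z}$, the writhe of $f$ is $$ w(f) = \sum_{i=0}^{2n} \sum_{j=1}^{n} \mathrm{sign}\left(f(i+j)-f(i)\right), $$ where $i+j$ is taken in $\mathbb{Z}_{2n+1}$, and $\mathrm{sign}(x)=+1$ if $x>0$ and $-1$ if $x<0$. A permutation in $S_{2n+1}$ is viewed as a bijection of $\{0,\dots,2n\}$, the domain being identified with $\mathbb{Z}_{2n+1}$ and the values $0,\dots,2n$ being compared as integers. The normalized writhe $W_{2n+1}$ converges in distribution, as $n\to\infty$, to a law $W$ on $\mathbb{R}$ which is uniquely determined by its moment generating function, given near $z=0$ by $E[e^{Wz}]=\exp\left(\sum_{m=1}^\infty \frac{\lambda_m}{m}z^m\right)$, where $\lambda_m = \frac{8^m(2^m-1)B_m^2}{2(m!)^2}$ for even $m$, $\lambda_m=0$ for odd $m$, and $B_m$ is the $m$th Bernoulli number ($x/(e^x-1)=\sum_{m\ge 0}B_m x^m/m!$).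 *)

theory Defs
  imports "HOL-Probability.Probability" "HOL-Computational_Algebra.Formal_Power_Series"
begin

(* The residues modulo 2n+1 are represented by 0, ..., 2n; only the values of f there matter.
   sgn agrees with the two-valued sign because f is only used for f injective on {..2n}. *)
definition writhe :: "nat \<Rightarrow> (nat \<Rightarrow> real) \<Rightarrow> real" where
  "writhe n f = (\<Sum>i=0..2*n. \<Sum>j=1..n. sgn (f ((i + j) mod (2*n + 1)) - f i))"

(* Law of w(p)/n for p uniform on the permutations of {0, ..., 2n}. The index is n, not the
   number 2n+1 of points; for n = 0 it is the Dirac measure at 0. *)
definition normalized_writhe_law :: "nat \<Rightarrow> real measure" where
  "normalized_writhe_law n =
     distr (measure_pmf (pmf_of_set {p. p permutes {0..2*n}})) borel
       (\<lambda>p. writhe n (\<lambda>i. real (p i)) / real n)"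

(* The quotient fps_X / (fps_exp 1 - 1) is the formal power series x / (e^x - 1): both series
   vanish to order exactly 1, so the division is exact (see bernoulli_fps_mult). *)
definition bernoulli_num :: "nat \<Rightarrow> real" where
  "bernoulli_num m = fact m * fps_nth (fps_X / (fps_exp 1 - 1)) m"

lemma bernoulli_fps_mult:
  "Abs_fps (\<lambda>m. bernoulli_num m / fact m) * (fps_exp 1 - 1) = fps_X"
proof -
  have nz: "fps_nth (fps_exp (1::real) - 1) 1 \<noteq> 0" by simp
  then have ne: "fps_exp (1::real) - 1 \<noteq> 0" by fastforce
  have "subdegree (fps_exp (1::real) - 1) = 1"
    by (rule subdegreeI) auto
  then have "fps_exp (1::real) - 1 dvd fps_X"
    using ne by (simp add: fps_dvd_iff)
  moreover have "Abs_fps (\<lambda>m. bernoulli_num m / fact m) = fps_X / (fps_exp 1 - 1)"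
    by (simp add: fps_eq_iff bernoulli_num_def)
  ultimately show ?thesis by simp
qed

definition writhe_coeff :: "nat \<Rightarrow> real" where
  "writhe_coeff m =
     (if even m then 8 ^ m * (2 ^ m - 1) * (bernoulli_num m)\<^sup>2 / (2 * (fact m)\<^sup>2) else 0)"

end

theory Submission
  imports Defs "HOL-Complex_Analysis.Complex_Analysis"
begin

text \<open>
  The moment generating function of \<open>A\<close> is \<open>sec (\<pi> z / 2)\<close>, by the substitution
  \<open>t = 1 / (1 + e\<^sup>-\<^sup>2\<^sup>x)\<close> in the Beta integral and the reflection formula. The series therefore
  has moment generating function \<open>\<Prod>n. sec (2 s / (\<pi> n))\<close>. Expanding the logarithm of the product for
  the sine gives \<open>-ln (cos (\<pi> u / 2)) = (\<Sum>r. (1 - 4\<^sup>-\<^sup>r) \<zeta>(2r) u\<^sup>2\<^sup>r / r)\<close>; summing over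
  \<open>u = 4 s / (\<pi>\<^sup>2 n)\<close> yields a second factor \<open>\<zeta>(2r)\<close>, and Euler's formula for \<open>\<zeta>(2r)\<close> turns
  \<open>\<zeta>(2r)\<^sup>2\<close> into the squared Bernoulli numbers in the generating function of \<open>W\<close>.
  A distribution with exponential moments is determined by its moment generating function near 0,
  because the latter extends holomorphically to a strip containing the imaginary axis.

  Almost sure convergence needs no maximal inequality: evaluating the generating
  function of \<open>S\<^sub>K - S\<^sub>N\<close> at \<open>\<plusminus>\<surd>N\<close> bounds its fourth moment by a multiple of \<open>1 / N\<^sup>2\<close>, which is
  summable.
\<close>

section \<open>Even zeta values and the logarithm of the secant product\<close>

text \<open>Tonelli's theorem for series: nonnegativity upgrades \<open>sums\<close> to the
  unconditional \<open>has_sum\<close>, for which the sum over pairs may be taken in either order.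
  Both interchanges of summation below, over the factors of a product and over the powers of the
  variable, rest on it.\<close>

lemma sums_swap_nonneg:
  fixes a :: "nat \<Rightarrow> nat \<Rightarrow> real"
  assumes nonneg: "\<And>i j. a i j \<ge> 0"
    and f: "\<And>i. a i sums f i"
    and g: "\<And>j. (\<lambda>i. a i j) sums g j"
    and S: "g sums S"
  shows "f sums S"
proof -
  have hf: "(a i has_sum f i) UNIV" for i
    by (rule sums_nonneg_imp_has_sum[OF f nonneg])
  have hg: "((\<lambda>i. a i j) has_sum g j) UNIV" for j
    by (rule sums_nonneg_imp_has_sum[OF g nonneg])
  have "g j \<ge> 0" for j
    by (rule sums_le[OF _ sums_zero g]) (simp add: nonneg)
  then have hS: "(g has_sum S) UNIV"
    by (intro sums_nonneg_imp_has_sum S)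
  have "((\<lambda>(j, i). a i j) summable_on UNIV \<times> UNIV)"
    by (rule summable_on_SigmaI[where g = g]) (use hg hS nonneg in \<open>auto simp: summable_on_def\<close>)
  then have "((\<lambda>(j, i). a i j) has_sum S) (UNIV \<times> UNIV)"
    by (intro has_sum_SigmaI[where g = g]) (use hg hS in auto)
  then have "((\<lambda>(i, j). a i j) has_sum S) (UNIV \<times> UNIV)"
    by (subst has_sum_swap) (simp add: case_prod_unfold)
  then have "(f has_sum S) UNIV"
    by (rule has_sum_SigmaD) (use hf in auto)
  then show ?thesis
    by (rule has_sum_imp_sums)
qed

text \<open>The Riemann zeta function at a natural number. For \<open>m < 2\<close> the series
  diverges and the value carries no meaning, hence the side condition \<open>m >= 2\<close> in the
  facts below.\<close>

definition zeta_nat :: "nat \<Rightarrow> real" where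
  "zeta_nat m = (\<Sum>n. 1 / real (Suc n) ^ m)"

lemma zeta_nat_sums:
  assumes "m \<ge> 2"
  shows "(\<lambda>n. 1 / real (Suc n) ^ m) sums zeta_nat m"
proof -
  have "summable (\<lambda>n. inverse (real (Suc n) ^ m))"
    using inverse_power_summable[OF assms, where 'a = real] by (subst summable_Suc_iff) simp
  then show ?thesis
    unfolding zeta_nat_def by (simp add: summable_sums inverse_eq_divide)
qed

lemma zeta_nat_nonneg: "m \<ge> 2 \<Longrightarrow> zeta_nat m \<ge> 0"
  by (rule sums_le[OF _ sums_zero zeta_nat_sums]) auto

lemma zeta_nat_le: "m \<ge> 2 \<Longrightarrow> zeta_nat m \<le> zeta_nat 2"
  by (rule sums_le[OF _ zeta_nat_sums zeta_nat_sums])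
     (auto intro!: divide_left_mono power_increasing simp del: of_nat_Suc)

section \<open>The logarithm of Euler's sine product\<close>

lemma minus_ln_one_minus_sums:
  assumes "\<bar>x\<bar> < (1 :: real)"
  shows "(\<lambda>r. x ^ Suc r / real (Suc r)) sums (- ln (1 - x))"
proof -
  have "(\<lambda>n. - ((- (- x)) ^ n) / real n) sums ln (1 + (- x))"
    by (rule ln_series') (use assms in auto)
  from sums_minus[OF this] have "(\<lambda>n. x ^ n / real n) sums (- ln (1 - x))"
    by simp
  then show ?thesis
    by (subst sums_Suc_iff) simp
qed

lemma norm_less_one_less_radius:
  "norm x < 1 \<Longrightarrow> 1 \<le> R \<Longrightarrow> ereal (norm x) < R"
  by (rule less_le_trans[of _ 1]) auto

text \<open>Positivity makes the logarithm of this quotient a genuine one. The sine is odd, so the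
  case of negative \<open>u\<close> reduces to \<open>- u\<close>.\<close>

lemma sinc_pi_pos:
  assumes "0 < \<bar>u\<bar>" "\<bar>u\<bar> < (1 :: real)"
  shows "sin (pi * u) / (pi * u) > 0"
proof (cases "u > 0")
  case True
  then show ?thesis using assms by (auto intro!: divide_pos_pos sin_gt_zero)
next
  case False
  with assms have u: "0 < - u" "- u < 1" by auto
  have "sin (pi * (- u)) > 0"
    using mult_strict_left_mono[OF u(2) pi_gt_zero] mult_pos_pos[OF pi_gt_zero u(1)]
    by (intro sin_gt_zero) auto
  then show ?thesis using False assms by (auto intro!: divide_neg_neg mult_pos_neg)
qed

text \<open>Euler's product writes \<open>sin (pi * u) / (pi * u)\<close> as the product of the
  factors \<open>1 - u^2 / k^2\<close>. Expanding the logarithm of each factor and summing over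
  \<open>k\<close> first leaves \<open>zeta(2r) / r\<close> as the coefficient of
  \<open>u^(2r)\<close>. The point \<open>u = 0\<close> is excluded because the quotient has the
  value 0 there, not 1.\<close>

lemma ln_sin_sums:
  assumes u: "0 < \<bar>u\<bar>" "\<bar>u\<bar> < (1 :: real)"
  shows "(\<lambda>r. zeta_nat (2 * Suc r) * u ^ (2 * Suc r) / real (Suc r))
           sums (- ln (sin (pi * u) / (pi * u)))"
proof -
  define x where "x n = u\<^sup>2 / (real (Suc n))\<^sup>2" for n
  have u2: "u\<^sup>2 < 1" using u by (simp add: abs_square_less_1)
  have x: "0 \<le> x n" "x n < 1" for n
  proof -
    have "u\<^sup>2 / (real (Suc n))\<^sup>2 \<le> u\<^sup>2 / 1"
      by (intro divide_left_mono) auto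
    then show "x n < 1" using u2 unfolding x_def by linarith
  qed (simp add: x_def)
  have "(\<lambda>n. ln (\<Prod>k=1..n. 1 - u\<^sup>2 / (real k)\<^sup>2)) \<longlonglongrightarrow> ln (sin (pi * u) / (pi * u))"
    using u sinc_pi_pos[OF u] by (intro tendsto_ln sin_product_formula_real') auto
  also have "(\<lambda>n. ln (\<Prod>k=1..n. 1 - u\<^sup>2 / (real k)\<^sup>2)) = (\<lambda>n. \<Sum>k<n. ln (1 - x k))"
  proof
    fix n
    have "(\<Prod>k=1..n. 1 - u\<^sup>2 / (real k)\<^sup>2) = (\<Prod>k<n. 1 - x k)"
      unfolding x_def by (rule prod.reindex_bij_witness[of _ Suc "\<lambda>k. k - 1"]) auto
    then show "ln (\<Prod>k=1..n. 1 - u\<^sup>2 / (real k)\<^sup>2) = (\<Sum>k<n. ln (1 - x k))"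
      using x(2) by (simp add: ln_prod less_imp_neq)
  qed
  finally have S: "(\<lambda>n. - ln (1 - x n)) sums (- ln (sin (pi * u) / (pi * u)))"
    using sums_minus unfolding sums_def by (auto intro: tendsto_minus simp: sum_negf)
  \<comment> \<open>Rows are the logarithm series of the single factors; columns collect one fixed
    power of \<open>u\<close> over all factors.\<close>
  show ?thesis
  proof (rule sums_swap_nonneg[OF _ _ _ S])
    show "(\<lambda>r. x n ^ Suc r / real (Suc r)) sums (- ln (1 - x n))" for n
      using x[of n] by (intro minus_ln_one_minus_sums) auto
    show "(\<lambda>n. x n ^ Suc r / real (Suc r)) sums
            (zeta_nat (2 * Suc r) * u ^ (2 * Suc r) / real (Suc r))" for r
    proof -
      have "(\<lambda>n. u ^ (2 * Suc r) / real (Suc r) * (1 / real (Suc n) ^ (2 * Suc r)))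
              sums (u ^ (2 * Suc r) / real (Suc r) * zeta_nat (2 * Suc r))"
        by (intro sums_mult zeta_nat_sums) auto
      then show ?thesis
        by (simp only: x_def power_divide power_mult [symmetric] divide_divide_eq_left
            times_divide_eq_left times_divide_eq_right mult_1_right mult_ac) simp
    qed
  qed (simp add: x)
qed

text \<open>
  The Taylor series of \<open>\<pi> X cot (\<pi> X)\<close>, over the complex numbers so that the sine can be
  written in terms of exponentials.
\<close>

definition zeta_fps :: "complex fps" where
  "zeta_fps = Abs_fps (\<lambda>m. if m = 0 then 1 else if even m then - of_real (2 * zeta_nat m) else 0)"

text \<open>If \<open>C\<close> is the Taylor series of \<open>- ln (sin (pi u) / (pi u))\<close>,
  then \<open>C' = 1/u - pi cot (pi u)\<close>, so \<open>1 - u C'\<close> is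
  \<open>pi u cot (pi u)\<close>. The calculation is done over the reals, where the logarithm is
  available, and its coefficients are then moved to the complex numbers. The identity is stated
  multiplied by the sine to avoid a quotient.\<close>

lemma eval_zeta_fps:
  shows "fps_conv_radius zeta_fps \<ge> 1"
    and "\<And>u. 0 < \<bar>u\<bar> \<Longrightarrow> \<bar>u\<bar> < (1 :: real) \<Longrightarrow>
           eval_fps zeta_fps (of_real u) * sin (of_real (pi * u)) = of_real (pi * u * cos (pi * u))"
proof -
  \<comment> \<open>With \<open>m = 2 * r\<close> the coefficient \<open>zeta(2r) / r\<close>
    becomes \<open>2 * zeta(m) / m\<close>; differentiation then cancels the denominator.\<close>
  define C where "C = Abs_fps (\<lambda>m. if even m \<and> m > 0 then 2 * zeta_nat m / real m else 0)"
  have C_sums: "(\<lambda>m. fps_nth C m * u ^ m) sums (- ln (sin (pi * u) / (pi * u)))"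
    if "0 < \<bar>u\<bar>" "\<bar>u\<bar> < 1" for u :: real
  proof -
    have "strict_mono (\<lambda>r :: nat. 2 * Suc r)"
      by (rule strict_monoI) auto
    moreover have "m \<in> range (\<lambda>r :: nat. 2 * Suc r)" if "even m" "m > 0" for m
    proof -
      from that have "m = 2 * Suc (m div 2 - 1)" by auto
      then show ?thesis by blast
    qed
    ultimately have "((\<lambda>r. fps_nth C (2 * Suc r) * u ^ (2 * Suc r)) sums (- ln (sin (pi * u) / (pi * u))))
        \<longleftrightarrow> ((\<lambda>m. fps_nth C m * u ^ m) sums (- ln (sin (pi * u) / (pi * u))))"
      by (intro sums_mono_reindex) (auto simp: C_def)
    moreover have "(\<lambda>r. fps_nth C (2 * Suc r) * u ^ (2 * Suc r)) =
        (\<lambda>r. zeta_nat (2 * Suc r) * u ^ (2 * Suc r) / real (Suc r))"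
      by (auto simp: C_def field_simps)
    ultimately show ?thesis using ln_sin_sums[OF that] by simp
  qed
  \<comment> \<open>Convergence at one point of each modulus below 1 suffices.\<close>
  have rC: "fps_conv_radius C \<ge> 1"
    unfolding fps_conv_radius_def
  proof (rule conv_radius_geI_ex)
    fix r :: real assume "0 < r" "ereal r < 1"
    then show "\<exists>z. norm z = r \<and> summable (\<lambda>n. fps_nth C n * z ^ n)"
      using C_sums[of r] by (intro exI[of _ r]) (auto simp: sums_iff)
  qed
  define R where "R = 1 - fps_X * fps_deriv C"
  have rD: "fps_conv_radius (fps_deriv C) \<ge> 1"
    using rC fps_conv_radius_deriv[of C] by (rule order_trans)
  have rXD: "fps_conv_radius (fps_X * fps_deriv C) \<ge> 1"
    by (rule order_trans[OF _ fps_conv_radius_mult]) (use rD in auto)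
  have rR: "fps_conv_radius R \<ge> 1"
    unfolding R_def by (rule order_trans[OF _ fps_conv_radius_diff]) (use rXD in auto)
  have ZR: "fps_nth zeta_fps m = of_real (fps_nth R m)" for m
    by (cases m) (auto simp: zeta_fps_def R_def C_def simp del: of_nat_Suc)
  have "fps_conv_radius zeta_fps = fps_conv_radius R"
    unfolding fps_conv_radius_def unfolding conv_radius_def by (simp only: ZR norm_of_real real_norm_def)
  with rR show "fps_conv_radius zeta_fps \<ge> 1" by simp
  fix u :: real assume u: "0 < \<bar>u\<bar>" "\<bar>u\<bar> < 1"
  have nu: "ereal (norm u) < fps_conv_radius F" if "fps_conv_radius F \<ge> 1" for F :: "real fps"
    by (rule norm_less_one_less_radius) (use u that in auto)
  have sp: "sin (pi * u) / (pi * u) > 0" by (rule sinc_pi_pos[OF u])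
  then have s0: "sin (pi * u) \<noteq> 0" by auto
  have "(eval_fps C has_field_derivative eval_fps (fps_deriv C) u) (at u)"
    by (rule has_field_derivative_eval_fps) (rule nu[OF rC])
  then have dC: "((\<lambda>u. - ln (sin (pi * u) / (pi * u))) has_field_derivative eval_fps (fps_deriv C) u) (at u)"
    if "eventually (\<lambda>v. eval_fps C v = - ln (sin (pi * v) / (pi * v))) (nhds u)"
    using DERIV_cong_ev[OF refl that refl] by simp
  have "((\<lambda>u. - ln (sin (pi * u) / (pi * u))) has_field_derivative
      (1 / u - pi * cos (pi * u) / sin (pi * u))) (at u)"
    using sp s0 u by (auto intro!: derivative_eq_intros simp: field_simps)
  \<comment> \<open>The series and the closed form agree on a whole neighbourhood of
    \<open>u\<close> that avoids 0, so their derivatives at \<open>u\<close> agree.\<close>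
  moreover have "eventually (\<lambda>v. eval_fps C v = - ln (sin (pi * v) / (pi * v))) (nhds u)"
  proof -
    have "eventually (\<lambda>v. v \<in> {-1<..<1} - {0}) (nhds u)"
      using u by (intro eventually_nhds_in_open) auto
    then show ?thesis
    proof eventually_elim
      case (elim v)
      then show ?case using C_sums[of v] by (auto simp: eval_fps_def sums_iff)
    qed
  qed
  ultimately have D: "eval_fps (fps_deriv C) u = 1 / u - pi * cos (pi * u) / sin (pi * u)"
    using DERIV_unique[OF dC] by blast
  have "eval_fps R u = 1 - u * eval_fps (fps_deriv C) u"
    unfolding R_def using nu[OF rXD] nu[OF rD]
    by (simp add: eval_fps_diff eval_fps_mult)
  also have "\<dots> = pi * u * cos (pi * u) / sin (pi * u)"
    using u s0 by (simp add: D field_simps)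
  finally have eR: "eval_fps R u * sin (pi * u) = pi * u * cos (pi * u)"
    using s0 by simp
  have "eval_fps zeta_fps (of_real u) = of_real (eval_fps R u)"
    unfolding eval_fps_def ZR
    using suminf_of_real[OF summable_fps[OF nu[OF rR]], where 'a = complex] by simp
  then show "eval_fps zeta_fps (of_real u) * sin (of_real (pi * u)) = of_real (pi * u * cos (pi * u))"
    using eR by (simp only: sin_of_real of_real_mult [symmetric])
qed

text \<open>The identity of values on real points passes to formal series: a nonzero difference of
  convergent series would have an isolated zero at 0, yet it vanishes at all small positive
  reals.\<close>

lemma zeta_fps_sin: "zeta_fps * fps_sin (of_real pi) = fps_const (of_real pi) * fps_X * fps_cos (of_real pi)"
proof (rule ccontr)
  define D where "D = zeta_fps * fps_sin (of_real pi) - fps_const (of_real pi) * fps_X * fps_cos (of_real pi)"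
  assume "\<not> ?thesis"
  then have "D \<noteq> 0" by (simp add: D_def)
  then obtain m where m: "fps_nth D m \<noteq> 0" by (auto simp: fps_eq_iff)
  have "fps_nth D 0 = 0" by (simp add: D_def)
  with m have "m > 0" by (cases m) auto
  have r1: "fps_conv_radius (zeta_fps * fps_sin (of_real pi)) \<ge> 1"
    by (rule order_trans[OF _ fps_conv_radius_mult]) (use eval_zeta_fps in auto)
  have r2: "fps_conv_radius (fps_const (of_real pi) * fps_X * fps_cos (of_real pi) :: complex fps) \<ge> 1"
    by (rule order_trans[OF _ fps_conv_radius_mult])
       (use fps_conv_radius_mult[of "fps_const (of_real pi) :: complex fps" fps_X] in auto)
  have "fps_conv_radius D \<ge> 1"
    unfolding D_def by (rule order_trans[OF _ fps_conv_radius_diff]) (use r1 r2 in auto)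
  then have sm: "(\<lambda>n. fps_nth D n * (x - 0) ^ n) sums eval_fps D x" if "norm (x - 0) < 1" for x
    using sums_eval_fps[of x D] norm_less_one_less_radius[of x] that by simp
  obtain s where s: "0 < s" "\<And>z. z \<in> cball 0 s - {0} \<Longrightarrow> eval_fps D z \<noteq> 0"
    by (rule powser_0_nonzero[OF zero_less_one sm _ m \<open>m > 0\<close>])
       (use \<open>fps_nth D 0 = 0\<close> in \<open>auto simp: eval_fps_at_0\<close>)
  \<comment> \<open>A point that lies both in the punctured disc without zeros and in the range
    where the values are known.\<close>
  define u where "u = min s (1/2)"
  have u: "0 < \<bar>u\<bar>" "\<bar>u\<bar> < 1" "u \<le> s" "u > 0" using s(1) by (auto simp: u_def)
  have n1: "ereal (norm (of_real u :: complex)) < fps_conv_radius F"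
    if "fps_conv_radius F \<ge> 1" for F :: "complex fps"
    by (rule norm_less_one_less_radius) (use u that in auto)
  have "eval_fps D (of_real u) =
      eval_fps (zeta_fps * fps_sin (of_real pi)) (of_real u) - 
      eval_fps (fps_const (of_real pi) * fps_X * fps_cos (of_real pi)) (of_real u)"
    unfolding D_def by (rule eval_fps_diff) (use r1 r2 n1 in auto)
  also have "eval_fps (zeta_fps * fps_sin (of_real pi)) (of_real u) =
      eval_fps zeta_fps (of_real u) * sin (of_real (pi * u))"
    by (subst eval_fps_mult) (use eval_zeta_fps(1) n1 in auto)
  also have "\<dots> = of_real (pi * u * cos (pi * u))"
    by (rule eval_zeta_fps) (use u in auto)
  also have "eval_fps (fps_const (of_real pi) * fps_X * fps_cos (of_real pi)) (of_real u :: complex) =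
      of_real (pi * u) * cos (of_real (pi * u))"
    using fps_conv_radius_mult[of "fps_const (of_real pi) :: complex fps" fps_X]
    by (simp add: eval_fps_mult)
  also have "\<dots> = of_real (pi * u * cos (pi * u))"
    by (subst cos_of_real) (simp only: of_real_mult)
  finally show False using s(2)[of "of_real u"] u by auto
qed

section \<open>Euler's formula for the even zeta values\<close>

text \<open>With \<open>c = 2 pi i\<close>, the series \<open>c X / (exp (c X) - 1)\<close> equals
  \<open>pi X cot (pi X) - i pi X\<close>. The correction is linear, so for even \<open>m\<close>
  the coefficients of the Bernoulli series and of \<open>zeta_fps\<close> can be compared
  directly.\<close>

lemma bernoulli_zeta_nat:
  assumes "even m" "m > 0"
  shows "of_real (bernoulli_num m / fact m) * (2 * of_real pi * \<i>) ^ m = - 2 * of_real (zeta_nat m)"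
proof -
  define c where "c = 2 * of_real pi * \<i>"
  define B where "B = Abs_fps (\<lambda>m. complex_of_real (bernoulli_num m / fact m))"
  define Bc where "Bc = fps_compose B (fps_const c * fps_X)"
  define E where "E = fps_exp (\<i> * of_real pi)"
  define F where "F = fps_exp (- \<i> * of_real pi)"
  have lin: "fps_nth (fps_const c * fps_X) 0 = 0" by simp
  have "B * (fps_exp 1 - 1) = fps_X"
  proof (rule fps_ext)
    fix n
    have "fps_nth (B * (fps_exp 1 - 1)) n =
        of_real (fps_nth (Abs_fps (\<lambda>m. bernoulli_num m / fact m) * (fps_exp 1 - 1)) n)"
      unfolding fps_mult_nth of_real_sum by (intro sum.cong) (auto simp: B_def)
    then show "fps_nth (B * (fps_exp 1 - 1)) n = fps_nth fps_X n"
      by (simp add: bernoulli_fps_mult fps_X_def)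
  qed
  then have Bc: "Bc * (fps_exp c - 1) = fps_const c * fps_X"
    using arg_cong[of _ _ "\<lambda>f. fps_compose f (fps_const c * fps_X)"]
    by (metis Bc_def fps_compose_mult_distrib[OF lin] fps_compose_sub_distrib fps_compose_1
        fps_exp_compose_linear mult.right_neutral fps_X_fps_compose_startby0[OF lin])
  have FE: "F * E = 1" by (simp add: E_def F_def fps_exp_add_mult [symmetric])
  have Ec: "fps_exp c = E * E"
    by (simp add: E_def c_def fps_exp_add_mult [symmetric] mult_ac)
  have Z: "zeta_fps * (E - F) = fps_const \<i> * (fps_const (of_real pi) * fps_X * (E + F))"
  proof -
    have s: "fps_const (2 * \<i>) * fps_sin (of_real pi) = E - F"
      unfolding fps_sin_fps_exp_ii E_def F_def by (simp add: fps_divide_unit mult.commute)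
    have c: "fps_const 2 * fps_cos (of_real pi) = E + F"
      unfolding fps_cos_fps_exp_ii E_def F_def by (simp add: fps_divide_unit mult.commute)
    have "zeta_fps * (E - F) = fps_const (2 * \<i>) * (zeta_fps * fps_sin (of_real pi))"
      by (simp add: s [symmetric] mult_ac)
    also have "\<dots> = fps_const \<i> * (fps_const (of_real pi) * fps_X * (fps_const 2 * fps_cos (of_real pi)))"
      by (simp add: zeta_fps_sin mult_ac flip: fps_const_mult)
    finally show ?thesis by (simp add: c)
  qed
  define X where "X = fps_const (\<i> * of_real pi) * fps_X"
  have "zeta_fps * (E - F) = X * (E + F)"
    using Z unfolding X_def by (simp add: mult_ac flip: fps_const_mult)
  \<comment> \<open>Multiplication by \<open>E\<close> removes \<open>F = 1 / E\<close> and leaves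
    only \<open>E * E = fps_exp c\<close>, the exponential in the Bernoulli series.\<close>
  then have "zeta_fps * (E * E - F * E) = X * (E * E + F * E)"
    by (metis (no_types) mult.assoc distrib_right left_diff_distrib)
  then have "zeta_fps * (E * E - 1) = X * (E * E + 1)"
    by (simp only: FE)
  then have "(zeta_fps - X) * (E * E - 1) = 2 * X"
    by (simp add: algebra_simps)
  moreover have "fps_const c * fps_X = 2 * X"
    by (simp add: X_def c_def fps_eq_iff numeral_fps_const)
  then have "Bc * (E * E - 1) = 2 * X"
    using Bc by (simp add: Ec)
  ultimately have "(zeta_fps - X) * (E * E - 1) = Bc * (E * E - 1)"
    by simp
  \<comment> \<open>The linear coefficient is \<open>c\<close>, which is nonzero; the common factor
    can therefore be cancelled.\<close>
  moreover have "E * E - 1 \<noteq> 0"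
  proof
    assume "E * E - 1 = 0"
    then have "fps_nth (fps_exp c - 1) 1 = 0" by (simp add: Ec)
    then show False by (simp add: c_def)
  qed
  ultimately have "zeta_fps - fps_const (\<i> * of_real pi) * fps_X = Bc"
    by (simp add: X_def)
  then have "fps_nth (zeta_fps - fps_const (\<i> * of_real pi) * fps_X) m = fps_nth Bc m" by simp
  moreover have "m \<noteq> 1" using assms by auto
  moreover have "fps_nth Bc m = c ^ m * of_real (bernoulli_num m / fact m)"
    by (simp add: Bc_def B_def fps_compose_linear)
  ultimately show ?thesis
    using assms by (simp add: zeta_fps_def c_def fps_X_def mult.commute)
qed

text \<open>Squaring removes the imaginary unit and the sign, since \<open>i^(2m) = 1\<close> for
  even \<open>m\<close>. The coefficients \<open>writhe_coeff\<close> contain only the square of the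
  Bernoulli number.\<close>

lemma bernoulli_num_squared:
  assumes "even m" "m > 0"
  shows "(bernoulli_num m)\<^sup>2 * (2 * pi) ^ (2 * m) = (2 * fact m * zeta_nat m)\<^sup>2"
proof -
  have "((2 * of_real pi * \<i>) ^ m)\<^sup>2 = (2 * of_real pi * \<i>) ^ (2 * m)"
    by (simp add: power_mult [symmetric] mult.commute)
  also have "\<dots> = complex_of_real ((2 * pi) ^ (2 * m))"
    using assms by (simp add: power_mult_distrib power_mult)
  finally have c: "((2 * of_real pi * \<i>) ^ m)\<^sup>2 = complex_of_real ((2 * pi) ^ (2 * m))" .
  have "complex_of_real ((bernoulli_num m / fact m)\<^sup>2 * (2 * pi) ^ (2 * m)) = 
      (of_real (bernoulli_num m / fact m) * (2 * of_real pi * \<i>) ^ m)\<^sup>2"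
    by (subst power_mult_distrib, subst c) (simp only: of_real_mult of_real_power)
  also have "\<dots> = of_real (4 * (zeta_nat m)\<^sup>2)"
    unfolding bernoulli_zeta_nat[OF assms] by (simp add: power_mult_distrib)
  finally have "(bernoulli_num m / fact m)\<^sup>2 * (2 * pi) ^ (2 * m) = 4 * (zeta_nat m)\<^sup>2"
    unfolding of_real_eq_iff .
  then show ?thesis by (simp add: field_simps)
qed

section \<open>Logarithms of the cosine and of the secant product\<close>

text \<open>The double-angle formula makes \<open>cos (pi u / 2)\<close> the quotient of
  \<open>sin x / x\<close> at \<open>x = pi u\<close> by its value at \<open>x = pi u / 2\<close>.
  Subtracting the two sine expansions produces the factor \<open>1 - 4^(-r)\<close>.\<close>

lemma minus_ln_cos_sums:
  assumes "\<bar>u\<bar> < (1 :: real)"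
  shows "(\<lambda>r. (1 - 1 / 4 ^ Suc r) * zeta_nat (2 * Suc r) * u ^ (2 * Suc r) / real (Suc r))
           sums (- ln (cos (pi * u / 2)))"
proof (cases "u = 0")
  case False
  have h: "0 < \<bar>u\<bar>" "0 < \<bar>u / 2\<bar>" "\<bar>u / 2\<bar> < 1" using False assms by auto
  have "(\<lambda>r. zeta_nat (2 * Suc r) * u ^ (2 * Suc r) / real (Suc r)
          - zeta_nat (2 * Suc r) * (u / 2) ^ (2 * Suc r) / real (Suc r))
      sums (- ln (sin (pi * u) / (pi * u)) - (- ln (sin (pi * (u / 2)) / (pi * (u / 2)))))"
    by (intro sums_diff ln_sin_sums h assms)
  also have "(\<lambda>r. zeta_nat (2 * Suc r) * u ^ (2 * Suc r) / real (Suc r)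
          - zeta_nat (2 * Suc r) * (u / 2) ^ (2 * Suc r) / real (Suc r)) = 
      (\<lambda>r. (1 - 1 / 4 ^ Suc r) * zeta_nat (2 * Suc r) * u ^ (2 * Suc r) / real (Suc r))"
  proof
    fix r
    have "(2 :: real) ^ (2 * Suc r) = 4 ^ Suc r" by (subst power_mult) simp
    then show "zeta_nat (2 * Suc r) * u ^ (2 * Suc r) / real (Suc r)
          - zeta_nat (2 * Suc r) * (u / 2) ^ (2 * Suc r) / real (Suc r) = 
        (1 - 1 / 4 ^ Suc r) * zeta_nat (2 * Suc r) * u ^ (2 * Suc r) / real (Suc r)"
      by (simp add: power_divide field_simps del: of_nat_Suc power_Suc mult_Suc_right)
  qed
  also have "- ln (sin (pi * u) / (pi * u)) - (- ln (sin (pi * (u / 2)) / (pi * (u / 2)))) =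
      - ln (cos (pi * u / 2))"
  proof -
    have p: "sin (pi * u) / (pi * u) > 0" "sin (pi * (u / 2)) / (pi * (u / 2)) > 0"
      using h assms by (auto intro!: sinc_pi_pos simp del: times_divide_eq_right)
    have "sin (pi * u) = 2 * sin (pi * u / 2) * cos (pi * u / 2)"
      using sin_double[of "pi * u / 2"] by simp
    then have "cos (pi * u / 2) = (sin (pi * u) / (pi * u)) / (sin (pi * (u / 2)) / (pi * (u / 2)))"
      using p False by (auto simp: field_simps)
    then have "ln (cos (pi * u / 2)) =
        ln (sin (pi * u) / (pi * u)) - ln (sin (pi * (u / 2)) / (pi * (u / 2)))"
      using p by (simp only: ln_divide_pos)
    then show ?thesis by linarith
  qed
  finally show ?thesis .
qed auto

lemma cos_prod_sums:
  assumes s: "\<bar>s\<bar> < (1 :: real)"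
  shows "(\<lambda>n. - ln (cos (2 * s / (pi * real (Suc n)))))
           sums (\<Sum>m. writhe_coeff (Suc m) / real (Suc m) * s ^ Suc m)"
proof -
  \<comment> \<open>Chosen so that \<open>2 s / (pi n) = pi (v / n) / 2\<close>; the cosine
    expansion then applies with \<open>u = v / n\<close>, and \<open>pi^2 > 4\<close> keeps
    \<open>v\<close> inside its range.\<close>
  define v where "v = 4 * s / pi\<^sup>2"
  have "pi\<^sup>2 > 2\<^sup>2" using pi_gt3 by (intro power_strict_mono) auto
  then have v: "\<bar>v\<bar> < 1"
    using s by (simp add: v_def abs_mult field_simps)
  define b where "b r = (1 - 1 / 4 ^ Suc r) * (zeta_nat (2 * Suc r))\<^sup>2 * v ^ (2 * Suc r) / real (Suc r)" for r
  define t where "t m = (if m = 0 then 0 else writhe_coeff m / real m * s ^ m)" for m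
  \<comment> \<open>The terms \<open>b\<close> carry two zeta factors, one from the cosine expansion
    and one from the sum over \<open>n\<close>; Euler's formula identifies them with the nonzero
    terms of the target series.\<close>
  have tb: "t (2 * Suc r) = b r" for r
  proof -
    define m where "m = 2 * Suc r"
    have m: "even m" "m > 0" "real (Suc r) = real m / 2" by (auto simp: m_def)
    have q: "(4 :: real) ^ Suc r = 2 ^ m" unfolding m_def by (subst power_mult) simp
    have "(bernoulli_num m)\<^sup>2 = (2 * fact m * zeta_nat m)\<^sup>2 / (2 * pi) ^ (2 * m)"
      using bernoulli_num_squared[OF m(1,2)] by (simp add: field_simps)
    then have "writhe_coeff m = 8 ^ m * (2 ^ m - 1) * ((2 * fact m * zeta_nat m)\<^sup>2 / (2 * pi) ^ (2 * m)) / (2 * (fact m)\<^sup>2)"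
      using m by (simp add: writhe_coeff_def)
    also have "(2 * pi) ^ (2 * m) = 4 ^ m * pi ^ (2 * m)"
      by (simp add: power_mult power_mult_distrib)
    also have "8 ^ m * (2 ^ m - 1) * ((2 * fact m * zeta_nat m)\<^sup>2 / (4 ^ m * pi ^ (2 * m))) / (2 * (fact m)\<^sup>2)
        = 2 * (8 ^ m / 4 ^ m) * (2 ^ m - 1) * (zeta_nat m)\<^sup>2 / pi ^ (2 * m)"
      by (simp add: field_simps power2_eq_square)
    also have "(8 :: real) ^ m / 4 ^ m = 2 ^ m" by (simp flip: power_divide)
    finally have w: "writhe_coeff m = 2 * 2 ^ m * (2 ^ m - 1) * (zeta_nat m)\<^sup>2 / pi ^ (2 * m)" .
    have vm: "v ^ m = 2 ^ m * 2 ^ m * s ^ m / pi ^ (2 * m)"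
    proof -
      have "(4 :: real) ^ m = 2 ^ m * 2 ^ m" by (simp flip: power_mult_distrib)
      then show ?thesis by (simp add: v_def power_divide power_mult_distrib power_mult)
    qed
    have "b r = (1 - 1 / 2 ^ m) * (zeta_nat m)\<^sup>2 * v ^ m / (real m / 2)"
      by (simp only: b_def q m(3) flip: m_def)
    also have "\<dots> = t m" using m by (simp add: t_def w vm field_simps)
    finally show ?thesis by (simp add: m_def)
  qed
  have q4: "1 - 1 / 4 ^ Suc r \<ge> (0 :: real)" for r
    using one_le_power[of "4 :: real" "Suc r"] by (simp add: field_simps)
  have b0: "b r \<ge> 0" for r
    unfolding b_def power_mult by (intro divide_nonneg_nonneg mult_nonneg_nonneg q4) auto
  \<comment> \<open>Since \<open>zeta(2r) <= zeta(2)\<close>, a geometric series in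
    \<open>v^2\<close> dominates.\<close>
  have "summable b"
  proof (rule summable_comparison_test')
    show "summable (\<lambda>r. (zeta_nat 2)\<^sup>2 * (v\<^sup>2) ^ r)"
      using v by (intro summable_mult summable_geometric) (simp add: abs_square_less_1)
    fix r :: nat
    have "b r \<le> 1 * (zeta_nat 2)\<^sup>2 * (v\<^sup>2) ^ r / 1"
      unfolding b_def power_mult
      using v zeta_nat_nonneg zeta_nat_le
      by (intro frac_le mult_mono power_mono power_decreasing) 
         (auto simp: abs_square_le_1 abs_less_iff)
    then show "norm (b r) \<le> (zeta_nat 2)\<^sup>2 * (v\<^sup>2) ^ r" using b0[of r] by simp
  qed
  then have b: "b sums (\<Sum>r. b r)" by (rule summable_sums)
  have "(\<lambda>n. - ln (cos (pi * (v / real (Suc n)) / 2))) sums (\<Sum>r. b r)"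
  proof (rule sums_swap_nonneg[OF _ _ _ b])
    fix n :: nat
    have "\<bar>v / real (Suc n)\<bar> \<le> \<bar>v\<bar>" by (simp add: field_simps abs_mult)
    then show "(\<lambda>r. (1 - 1 / 4 ^ Suc r) * zeta_nat (2 * Suc r) * (v / real (Suc n)) ^ (2 * Suc r) / real (Suc r))
        sums (- ln (cos (pi * (v / real (Suc n)) / 2)))"
      using v by (intro minus_ln_cos_sums) linarith
  next
    fix n r :: nat
    show "(1 - 1 / 4 ^ Suc r) * zeta_nat (2 * Suc r) * (v / real (Suc n)) ^ (2 * Suc r) / real (Suc r) \<ge> 0"
      using zeta_nat_nonneg[of "2 * Suc r"]
      unfolding power_mult[of "v / real (Suc n)"]
      by (intro divide_nonneg_nonneg mult_nonneg_nonneg q4) auto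
  next
    fix r :: nat
    have "(\<lambda>n. (1 - 1 / 4 ^ Suc r) * zeta_nat (2 * Suc r) * v ^ (2 * Suc r) / real (Suc r) * (1 / real (Suc n) ^ (2 * Suc r)))
        sums ((1 - 1 / 4 ^ Suc r) * zeta_nat (2 * Suc r) * v ^ (2 * Suc r) / real (Suc r) * zeta_nat (2 * Suc r))"
      by (intro sums_mult zeta_nat_sums) auto
    moreover have "(1 - 1 / 4 ^ Suc r) * zeta_nat (2 * Suc r) * v ^ (2 * Suc r) / real (Suc r) * zeta_nat (2 * Suc r) = b r"
      by (simp add: b_def power2_eq_square)
    ultimately show "(\<lambda>n. (1 - 1 / 4 ^ Suc r) * zeta_nat (2 * Suc r) * (v / real (Suc n)) ^ (2 * Suc r) / real (Suc r)) sums b r"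
      by (simp only: power_divide times_divide_eq_right mult_1_right divide_divide_eq_left mult_ac) simp
  qed
  also have "(\<lambda>n. - ln (cos (pi * (v / real (Suc n)) / 2))) = (\<lambda>n. - ln (cos (2 * s / (pi * real (Suc n)))))"
    by (simp add: v_def power2_eq_square)
  also have "(\<Sum>r. b r) = (\<Sum>m. writhe_coeff (Suc m) / real (Suc m) * s ^ Suc m)"
  \<comment> \<open>The odd coefficients vanish, so reindexing by the positive even numbers loses
    nothing.\<close>
  proof -
    have "strict_mono (\<lambda>r :: nat. 2 * Suc r)"
      by (rule strict_monoI) auto
    moreover have "t m = 0" if "m \<notin> range (\<lambda>r. 2 * Suc r)" for m
    proof (cases "even m \<and> m > 0")
      case True
      then have "m = 2 * Suc (m div 2 - 1)" by auto
      then show ?thesis using that by blast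
    qed (auto simp: t_def writhe_coeff_def)
    ultimately have "(\<lambda>r. t (2 * Suc r)) sums (\<Sum>r. b r) \<longleftrightarrow> t sums (\<Sum>r. b r)"
      by (intro sums_mono_reindex) auto
    then have "t sums (\<Sum>r. b r)" using b by (simp only: tb)
    then have "(\<lambda>m. t (Suc m)) sums (\<Sum>r. b r)"
      by (subst sums_Suc_iff) (simp add: t_def)
    then show ?thesis by (simp add: t_def sums_iff)
  qed
  finally show ?thesis .
qed

section \<open>Moment generating functions\<close>

text \<open>The substitution \<open>t = 1 / (1 + exp (- 2 x))\<close> has
  \<open>dt = 2 t (1 - t) dx\<close> and turns the integral into \<open>Beta a b\<close>. Stating it
  as a nonnegative integral records finiteness together with the value.\<close>

lemma sech_mgf:
  assumes z: "\<bar>z\<bar> < (1 :: real)"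
  shows "(\<integral>\<^sup>+x. ennreal (exp (z * x) / (pi * cosh x)) \<partial>lborel) = ennreal (1 / cos (pi * z / 2))"
proof -
  \<comment> \<open>Because \<open>a + b = 1\<close>, the Beta value is
    \<open>Gamma a * Gamma (1 - a)\<close>, to which the reflection formula applies.\<close>
  define a b where "a = (1 + z) / 2" and "b = (1 - z) / 2"
  have ab: "a > 0" "b > 0" "a + b = 1" using z by (auto simp: a_def b_def field_simps)
  define f where "f t = t powr (a - 1) * (1 - t) powr (b - 1)" for t :: real
  define g where "g x = 1 / (1 + exp (- 2 * x))" for x :: real
  have pos: "1 + exp (- 2 * x) > (0 :: real)" for x by (simp add: add_pos_pos)
  have pos': "1 + exp (- 2 * x) \<noteq> (0 :: real)" for x using pos[of x] by simp
  have g01: "0 < g x" "1 - g x = exp (- 2 * x) * g x" for x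
    using pos[of x] by (auto simp: g_def field_simps)
  have "(f has_integral Beta a b) {0<..<1}"
    unfolding f_def using has_integral_Beta_real[OF ab(1,2)] by (simp add: has_integral_Icc_iff_Ioo)
  then have "f absolutely_integrable_on {0<..<1} \<and> integral {0<..<1} f = Beta a b"
    by (intro conjI nonnegative_absolutely_integrable_1 integral_unique) (auto simp: f_def)
  moreover have "g ` UNIV = {0<..<1}"
  proof (intro set_eqI iffI)
    fix t assume "t \<in> range g"
    then obtain x where t: "t = g x" by auto
    have "1 - g x > 0" unfolding g01(2) using g01(1)[of x] by simp
    then show "t \<in> {0<..<1}" using g01(1)[of x] t by auto
  next
    fix t :: real assume t: "t \<in> {0<..<1}"
    then have "t = g (- ln (1 / t - 1) / 2)" by (simp add: g_def)
    then show "t \<in> range g" by (rule range_eqI)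
  qed
  ultimately have "f absolutely_integrable_on (g ` UNIV) \<and> integral (g ` UNIV) f = Beta a b"
    by simp
  moreover have "(g has_field_derivative 2 * exp (- 2 * x) * (g x)\<^sup>2) (at x within UNIV)" for x
    unfolding g_def using pos'[of x] by (auto intro!: derivative_eq_intros simp: power2_eq_square)
  moreover have "inj_on g UNIV" by (auto simp: inj_on_def g_def)
  ultimately have ai: "(\<lambda>x. \<bar>2 * exp (- 2 * x) * (g x)\<^sup>2\<bar> * f (g x)) absolutely_integrable_on UNIV \<and>
      integral UNIV (\<lambda>x. \<bar>2 * exp (- 2 * x) * (g x)\<^sup>2\<bar> * f (g x)) = Beta a b"
    by (subst has_absolute_integral_change_of_variables_1') auto
  \<comment> \<open>The Jacobian raises both Beta exponents by one, and
    \<open>1 - g x = exp (- 2 x) * g x\<close> merges the two powers into \<open>g x\<close> since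
    \<open>a + b = 1\<close>.\<close>
  have eq: "\<bar>2 * exp (- 2 * x) * (g x)\<^sup>2\<bar> * f (g x) = exp (z * x) / cosh x" for x
  proof -
    have "exp (- 2 * x) * (g x)\<^sup>2 * f (g x) = g x powr 1 * g x powr (a - 1) * ((1 - g x) powr 1 * (1 - g x) powr (b - 1))"
      using g01[of x] by (simp add: f_def power2_eq_square)
    also have "\<dots> = g x powr a * (1 - g x) powr b"
      by (simp only: powr_add [symmetric]) simp
    also have "\<dots> = g x powr a * g x powr b * exp (- 2 * x) powr b"
      using g01(1)[of x] unfolding g01(2) by (simp add: powr_mult)
    also have "\<dots> = g x * exp (- 2 * x * b)"
      using g01(1)[of x] ab by (simp add: powr_add [symmetric] exp_powr_real)
    also have "- 2 * x * b = z * x + - x" by (simp add: b_def field_simps)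
    also have "g x * exp (z * x + - x) = exp (z * x) * (exp (- x) / (1 + exp (- x) * exp (- x)))"
      by (simp add: g_def exp_add [symmetric] exp_diff exp_minus field_simps)
    also have "exp (- x) / (1 + exp (- x) * exp (- x)) = 1 / (2 * cosh x)"
    proof -
      have "1 + exp x * exp x \<noteq> 0" using add_pos_pos[OF zero_less_one, of "exp x * exp x"] by simp
      moreover from this have "2 + exp x * (exp x * 2) \<noteq> 0" by linarith
      ultimately show ?thesis by (simp add: cosh_def exp_minus field_simps)
    qed
    finally show ?thesis by (simp add: abs_mult)
  qed
  have "((\<lambda>x. exp (z * x) / cosh x) has_integral Beta a b) UNIV"
    using ai unfolding eq by (auto simp: has_integral_iff dest: set_lebesgue_integral_eq_integral(1))
  moreover have "Beta a b = pi / cos (pi * z / 2)"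
  proof -
    have "complex_of_real (Gamma a * Gamma (1 - a)) = of_real (pi / sin (pi * a))"
      using Gamma_reflection_complex[of "of_real a"]
      by (simp add: sin_of_real [symmetric] Gamma_complex_of_real [symmetric])
    then have "Gamma a * Gamma (1 - a) = pi / sin (pi * a)" unfolding of_real_eq_iff .
    moreover have "sin (pi * a) = cos (pi * z / 2)"
    proof -
      have "pi * a = pi / 2 + pi * z / 2" by (simp add: a_def field_simps)
      then show ?thesis by (simp add: sin_add)
    qed
    moreover have "1 - a = b" using ab by simp
    ultimately show ?thesis using ab by (simp add: Beta_def)
  qed
  ultimately have "((\<lambda>x. exp (z * x) / cosh x / pi) has_integral (pi / cos (pi * z / 2) / pi)) UNIV"
    by (intro has_integral_divide) simp
  then have "((\<lambda>x. exp (z * x) / (pi * cosh x)) has_integral (1 / cos (pi * z / 2))) UNIV"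
    by (simp add: mult.commute)
  then show ?thesis
    by (intro nn_integral_has_integral_lborel)
       (auto intro!: borel_measurable_continuous_onI continuous_intros)
qed

section \<open>Uniqueness for distributions with exponential moments\<close>

lemma power_div_fact_le_exp:
  assumes "x \<ge> (0 :: real)"
  shows "x ^ n / fact n \<le> exp x"
proof -
  have "(\<lambda>k. x ^ k /\<^sub>R fact k) sums exp x" by (rule exp_converges)
  then have "(\<Sum>k\<in>{n}. x ^ k /\<^sub>R fact k) \<le> exp x"
    using sum_le_suminf[of "\<lambda>k. x ^ k /\<^sub>R fact k" "{n}"] assms by (simp add: sums_iff)
  then show ?thesis by (simp add: divide_inverse mult.commute)
qed

lemma abs_power_le_exp: "\<bar>x :: real\<bar> ^ n \<le> fact n * (exp x + exp (- x))"
proof -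
  have "\<bar>x\<bar> ^ n \<le> fact n * exp \<bar>x\<bar>"
    using power_div_fact_le_exp[of "\<bar>x\<bar>" n] by (simp add: field_simps)
  also have "\<dots> \<le> fact n * (exp x + exp (- x))"
    by (intro mult_left_mono) (auto simp: abs_if)
  finally show ?thesis .
qed

context real_distribution
begin

text \<open>Differentiation under the integral sign: the second-order Taylor remainder of the
  integrand is at most \<open>|h|^2\<close> times an integrable function, so the difference quotient
  is within \<open>K |h|\<close> of the integral of the derivative.\<close>

lemma holomorphic_complex_mgf:
  assumes int: "\<And>s. \<bar>s\<bar> < \<delta> \<Longrightarrow> integrable M (\<lambda>x. exp (x * s))"
  shows "(\<lambda>z. \<integral>x. exp (z * complex_of_real x) \<partial>M) holomorphic_on {z. \<bar>Re z\<bar> < \<delta>}"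
proof -
  have bound: "integrable M f"
    if [measurable]: "f \<in> borel_measurable M" and "\<bar>s\<bar> < \<delta>" and
      le: "\<And>x. norm (f x) \<le> C * (exp (x * s) + exp (x * (- s)))" for f :: "real \<Rightarrow> complex" and C s
    by (rule Bochner_Integration.integrable_bound[where f = "\<lambda>x. C * (exp (x * s) + exp (x * (- s)))"])
       (use that order_trans[OF le abs_ge_self] int[of s] int[of "- s"] in auto)
  define F where "F z = (\<integral>x. exp (z * complex_of_real x) \<partial>M)" for z
  have "\<exists>D. (F has_field_derivative D) (at z)" if z: "\<bar>Re z\<bar> < \<delta>" for z
  proof -
    \<comment> \<open>A third of the distance to the boundary of the strip: one \<open>r\<close>
      pays for the shift by \<open>h\<close>, a second for the polynomial factor in
      \<open>x\<close>, and \<open>s = |Re z| + 2 r\<close> still lies below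
      \<open>\<delta>\<close>.\<close>
    define r where "r = (\<delta> - \<bar>Re z\<bar>) / 3"
    define s where "s = \<bar>Re z\<bar> + 2 * r"
    define G where "G x = exp (x * s) + exp (x * (- s))" for x :: real
    have r: "r > 0" "0 \<le> s" "\<bar>s\<bar> < \<delta>" using z by (auto simp: r_def s_def field_simps)
    have G: "exp (s * \<bar>x\<bar>) \<le> G x" for x
      by (auto simp: G_def abs_if mult.commute)
    have G_int: "integrable M G" unfolding G_def using r int[of s] int[of "- s"] by auto
    have z_exp: "norm (exp (z * of_real x)) \<le> exp (\<bar>Re z\<bar> * \<bar>x\<bar>)" for x
      by (simp add: abs_mult [symmetric])
    have x_exp: "\<bar>x\<bar> ^ n \<le> fact n / r ^ n * exp (r * \<bar>x\<bar>)" for x n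
      using power_div_fact_le_exp[of "r * \<bar>x\<bar>" n] r by (simp add: field_simps power_mult_distrib)
    have r_G: "exp (\<bar>Re z\<bar> * \<bar>x\<bar>) * (exp (r * \<bar>x\<bar>) * exp (r * \<bar>x\<bar>)) \<le> G x" for x
    proof -
      have "exp (\<bar>Re z\<bar> * \<bar>x\<bar>) * (exp (r * \<bar>x\<bar>) * exp (r * \<bar>x\<bar>)) = exp (s * \<bar>x\<bar>)"
        unfolding exp_add [symmetric] by (simp add: s_def algebra_simps)
      then show ?thesis using G[of x] by simp
    qed
    have intz: "integrable M (\<lambda>x. exp ((z + h) * of_real x))" if "norm h \<le> r" for h
    proof (rule bound[OF _ r(3)])
      fix x :: real
      have "Re (z + h) * x \<le> \<bar>Re z + Re h\<bar> * \<bar>x\<bar>" by (simp add: abs_mult [symmetric])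
      also have "\<dots> \<le> s * \<bar>x\<bar>"
        using that abs_Re_le_cmod[of h] r by (intro mult_right_mono) (auto simp: s_def)
      finally show "norm (exp ((z + h) * of_real x)) \<le> 1 * (exp (x * s) + exp (x * (- s)))"
        using G[of x] by (auto simp: G_def intro: order_trans)
    qed measurable
    have intD: "integrable M (\<lambda>x. of_real x * exp (z * of_real x))"
    proof (rule bound[OF _ r(3)])
      fix x :: real
      have "norm (of_real x * exp (z * of_real x)) \<le> (1 / r * exp (r * \<bar>x\<bar>)) * exp (\<bar>Re z\<bar> * \<bar>x\<bar>)"
        unfolding norm_mult using x_exp[of x 1] z_exp[of x] r by (intro mult_mono) auto
      also have "\<dots> = 1 / r * (exp (\<bar>Re z\<bar> * \<bar>x\<bar>) * (exp (r * \<bar>x\<bar>) * 1))" by simp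
      also have "\<dots> \<le> 1 / r * (exp (\<bar>Re z\<bar> * \<bar>x\<bar>) * (exp (r * \<bar>x\<bar>) * exp (r * \<bar>x\<bar>)))"
        using r by (intro mult_left_mono) auto
      also have "\<dots> \<le> 1 / r * G x" using r_G[of x] r by (intro mult_left_mono) auto
      finally show "norm (of_real x * exp (z * of_real x)) \<le> 1 / r * (exp (x * s) + exp (x * (- s)))"
        by (simp add: G_def)
    qed measurable
    define D where "D = (\<integral>x. of_real x * exp (z * of_real x) \<partial>M)"
    define K where "K = 2 / r ^ 2 * (\<integral>x. G x \<partial>M)"
    have le: "norm ((F (z + h) - F z) / h - D) \<le> K * norm h" if h: "norm h < r" "h \<noteq> 0" for h
    proof -
      define R where "R x = exp ((z + h) * of_real x) - exp (z * of_real x) - h * (of_real x * exp (z * of_real x))" for x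
      have R_int: "integrable M R"
        unfolding R_def using intz[of h] intz[of 0] intD h r by (intro Bochner_Integration.integrable_diff integrable_mult_right) auto
      have "norm (R x) \<le> (norm h)\<^sup>2 * (2 / r ^ 2 * G x)" for x
      proof -
        define w where "w = h * of_real x"
        have "\<bar>Re w\<bar> \<le> norm h * \<bar>x\<bar>"
          using abs_Re_le_cmod[of w] by (simp add: w_def norm_mult)
        also have "\<dots> \<le> r * \<bar>x\<bar>" using h by (intro mult_right_mono) auto
        finally have w: "\<bar>Re w\<bar> \<le> r * \<bar>x\<bar>" .
        \<comment> \<open>\<open>R\<close> is \<open>exp (z x)\<close> times the remainder of
          \<open>exp w\<close> after its linear term, hence of order \<open>|w|^2\<close>.\<close>
        have "R x = exp (z * of_real x) * (exp w - (\<Sum>k\<le>1. w ^ k / fact k))"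
          by (simp add: R_def w_def exp_add algebra_simps)
        also have "norm \<dots> \<le> exp (\<bar>Re z\<bar> * \<bar>x\<bar>) * (exp \<bar>Re w\<bar> * norm w ^ Suc 1 / fact 1)"
          unfolding norm_mult using z_exp[of x] Taylor_exp[of w 1] by (intro mult_mono) auto
        also have "\<dots> \<le> exp (\<bar>Re z\<bar> * \<bar>x\<bar>) * (exp (r * \<bar>x\<bar>) * ((norm h)\<^sup>2 * (fact 2 / r ^ 2 * exp (r * \<bar>x\<bar>))))"
        proof (rule mult_left_mono)
          have "exp \<bar>Re w\<bar> * norm w ^ Suc 1 / fact 1 = exp \<bar>Re w\<bar> * ((norm h)\<^sup>2 * \<bar>x\<bar> ^ 2)"
            by (simp add: w_def norm_mult power_mult_distrib power2_eq_square)
          also have "\<dots> \<le> exp (r * \<bar>x\<bar>) * ((norm h)\<^sup>2 * (fact 2 / r ^ 2 * exp (r * \<bar>x\<bar>)))"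
            using w x_exp[of x 2] by (intro mult_mono mult_left_mono) auto
          finally show "exp \<bar>Re w\<bar> * norm w ^ Suc 1 / fact 1 \<le>
              exp (r * \<bar>x\<bar>) * ((norm h)\<^sup>2 * (fact 2 / r ^ 2 * exp (r * \<bar>x\<bar>)))" .
        qed auto
        also have "\<dots> = (norm h)\<^sup>2 * (2 / r ^ 2 * (exp (\<bar>Re z\<bar> * \<bar>x\<bar>) * (exp (r * \<bar>x\<bar>) * exp (r * \<bar>x\<bar>))))"
          by (simp add: mult_ac)
        also have "\<dots> \<le> (norm h)\<^sup>2 * (2 / r ^ 2 * G x)"
          using r_G[of x] by (intro mult_left_mono) auto
        finally show ?thesis .
      qed
      then have "norm (\<integral>x. R x \<partial>M) \<le> (\<integral>x. (norm h)\<^sup>2 * (2 / r ^ 2 * G x) \<partial>M)"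
        using G_int by (intro Bochner_Integration.integral_norm_bound_integral R_int) auto
      also have "\<dots> = (norm h)\<^sup>2 * K" by (simp add: K_def)
      also have "(\<integral>x. R x \<partial>M) = F (z + h) - F z - h * D"
        unfolding R_def F_def D_def using intz[of h] intz[of 0] intD h r by simp
      finally have "norm (F (z + h) - F z - h * D) / norm h \<le> (norm h)\<^sup>2 * K / norm h"
        using h by (intro divide_right_mono) auto
      moreover have "(F (z + h) - F z) / h - D = (F (z + h) - F z - h * D) / h"
        using h by (simp add: field_simps)
      ultimately show ?thesis
        using h by (simp add: norm_divide power2_eq_square mult.commute)
    qed
    have "((\<lambda>h. (F (z + h) - F z) / h - D) \<longlongrightarrow> 0) (at 0)"
    proof (rule Lim_null_comparison)
      show "eventually (\<lambda>h. norm ((F (z + h) - F z) / h - D) \<le> K * norm h) (at 0)"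
        unfolding eventually_at using le r by (intro exI[of _ r]) auto
      show "((\<lambda>h. K * norm h) \<longlongrightarrow> 0) (at (0::complex))"
        by (intro tendsto_eq_intros | simp)+
    qed
    then have "(F has_field_derivative D) (at z)"
      unfolding DERIV_def by (rule LIM_zero_cancel)
    then show ?thesis ..
  qed
  moreover have "open {z. \<bar>Re z\<bar> < \<delta>}"
    by (intro open_Collect_less continuous_intros)
  ultimately have "F holomorphic_on {z. \<bar>Re z\<bar> < \<delta>}"
    by (subst holomorphic_on_open) auto
  then show ?thesis by (simp add: F_def [abs_def])
qed

end

text \<open>The difference of the two complex generating functions is holomorphic on a strip and
  vanishes on a real segment, so it vanishes throughout by the identity theorem. On the imaginary
  axis this is equality of characteristic functions.\<close>

lemma mgf_determines_distribution:
  assumes "real_distribution \<mu>" "real_distribution \<nu>" "\<delta> > 0"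
    and int: "\<And>s. \<bar>s\<bar> < \<delta> \<Longrightarrow> integrable \<mu> (\<lambda>x. exp (x * s))"
    and int': "\<And>s. \<bar>s\<bar> < \<delta> \<Longrightarrow> integrable \<nu> (\<lambda>x. exp (x * s))"
    and eq: "\<And>s. \<bar>s\<bar> < \<delta> \<Longrightarrow> (\<integral>x. exp (x * s) \<partial>\<mu>) = (\<integral>x. exp (x * s) \<partial>\<nu>)"
  shows "\<mu> = \<nu>"
proof (rule Levy_uniqueness[OF assms(1,2)])
  interpret \<mu>: real_distribution \<mu> by fact
  interpret \<nu>: real_distribution \<nu> by fact
  define S where "S = {z. \<bar>Re z\<bar> < \<delta>}"
  define f where "f z = (\<integral>x. exp (z * complex_of_real x) \<partial>\<mu>) - (\<integral>x. exp (z * complex_of_real x) \<partial>\<nu>)" for z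
  have S_eq: "S = {z. Re z < \<delta>} \<inter> {z. Re z > - \<delta>}" by (auto simp: S_def abs_less_iff)
  have "convex S" unfolding S_eq by (intro convex_Int convex_halfspace_Re_lt convex_halfspace_Re_gt)
  moreover have "open S" unfolding S_eq by (intro open_Int open_halfspace_Re_lt open_halfspace_Re_gt)
  moreover have "f holomorphic_on S"
    unfolding f_def S_def
    by (intro holomorphic_on_diff \<mu>.holomorphic_complex_mgf \<nu>.holomorphic_complex_mgf int int')
  moreover have "f z = 0" if "z \<in> S \<inter> \<real>" for z
  proof -
    from that obtain s where s: "z = of_real s" "\<bar>s\<bar> < \<delta>" by (auto simp: S_def Reals_def)
    have "exp (z * complex_of_real x) = of_real (exp (x * s))" for x
      by (simp add: s exp_of_real [symmetric] mult.commute)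
    then show ?thesis using eq[OF s(2)] by (simp add: f_def)
  qed
  moreover have "0 islimpt (S \<inter> \<real>)"
    unfolding islimpt_approachable
  proof (intro allI impI)
    fix e :: real assume "e > 0"
    then show "\<exists>x'\<in>S \<inter> \<real>. x' \<noteq> 0 \<and> dist x' 0 < e"
      using \<open>\<delta> > 0\<close> by (intro bexI[of _ "of_real (min e \<delta> / 2)"]) (auto simp: S_def)
  qed
  ultimately have f0: "f z = 0" if "z \<in> S" for z
    using that \<open>\<delta> > 0\<close>
    by (intro analytic_continuation[of f S "S \<inter> \<real>" 0 z]) (auto intro: convex_connected simp: S_def)
  show "char \<mu> = char \<nu>"
  proof
    fix t :: real
    have "f (\<i> * of_real t) = 0" using \<open>\<delta> > 0\<close> by (intro f0) (simp add: S_def)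
    then show "char \<mu> t = char \<nu> t" by (simp add: f_def char_def mult.assoc)
  qed
qed

section \<open>The random series\<close>

text \<open>Combines \<open>cos y >= 1 - y^2 / 2\<close> with
  \<open>(1 + y^2) (1 - y^2 / 2) >= 1\<close> for \<open>y^2 <= 1\<close>. It bounds a product of
  secants by the exponential of a sum of squares.\<close>

lemma sec_le_exp:
  assumes "\<bar>y\<bar> \<le> (1 :: real)"
  shows "cos y > 0" "1 / cos y \<le> exp (y\<^sup>2)"
proof -
  have "(sin (y / 2))\<^sup>2 \<le> (y / 2)\<^sup>2"
    using power_mono[OF abs_sin_x_le_abs_x[of "y / 2"], of 2] by (simp only: power2_abs abs_ge_zero)
  then have c: "cos y \<ge> 1 - y\<^sup>2 / 2"
    using cos_double_sin[of "y / 2"] by (simp add: power_divide)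
  have y2: "y\<^sup>2 \<le> 1" using assms by (simp add: abs_square_le_1)
  then show pos: "cos y > 0" using c by linarith
  have "1 \<le> (1 + y\<^sup>2) * (1 - y\<^sup>2 / 2)"
    using mult_left_mono[OF y2, of "y\<^sup>2"] by (simp add: field_simps)
  also have "\<dots> \<le> exp (y\<^sup>2) * cos y"
    using c y2 exp_ge_add_one_self[of "y\<^sup>2"] by (intro mult_mono) auto
  finally show "1 / cos y \<le> exp (y\<^sup>2)" using pos by (simp add: field_simps)
qed

text \<open>Fatou's lemma: a bound on the integrals passes to the almost sure limit without any
  domination.\<close>

lemma nn_integral_le_of_AE_tendsto:
  fixes f :: "nat \<Rightarrow> 'a \<Rightarrow> real"
  assumes [measurable]: "\<And>k. f k \<in> borel_measurable M"
    and lim: "AE x in M. (\<lambda>k. f k x) \<longlonglongrightarrow> g x"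
    and le: "eventually (\<lambda>k. (\<integral>\<^sup>+x. ennreal (f k x) \<partial>M) \<le> c) sequentially"
  shows "(\<integral>\<^sup>+x. ennreal (g x) \<partial>M) \<le> c"
proof -
  have "(\<integral>\<^sup>+x. ennreal (g x) \<partial>M) = (\<integral>\<^sup>+x. liminf (\<lambda>k. ennreal (f k x)) \<partial>M)"
  proof (rule nn_integral_cong_AE)
    show "AE x in M. ennreal (g x) = liminf (\<lambda>k. ennreal (f k x))"
      using lim by eventually_elim (auto intro!: lim_imp_Liminf [symmetric] tendsto_ennrealI)
  qed
  also have "\<dots> \<le> liminf (\<lambda>k. \<integral>\<^sup>+x. ennreal (f k x) \<partial>M)"
    by (rule nn_integral_liminf) measurable
  also have "\<dots> \<le> c" by (rule Liminf_le) (use le in auto)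
  finally show ?thesis .
qed

text \<open>The integral of the sum is the sum of the integrals, hence finite, so the sum is finite
  almost everywhere.\<close>

lemma AE_summable_of_nn_integral_le:
  fixes f :: "nat \<Rightarrow> 'a \<Rightarrow> real"
  assumes [measurable]: "\<And>k. f k \<in> borel_measurable M"
    and nonneg: "\<And>k x. f k x \<ge> 0"
    and le: "\<And>k. (\<integral>\<^sup>+x. ennreal (f k x) \<partial>M) \<le> ennreal (c k)"
    and c: "summable c" "\<And>k. c k \<ge> 0"
  shows "AE x in M. summable (\<lambda>k. f k x)"
proof -
  have "(\<integral>\<^sup>+x. (\<Sum>k. ennreal (f k x)) \<partial>M) = (\<Sum>k. \<integral>\<^sup>+x. ennreal (f k x) \<partial>M)"
    by (rule nn_integral_suminf) measurable
  also have "\<dots> \<le> (\<Sum>k. ennreal (c k))"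
    by (intro suminf_le le) auto
  also have "\<dots> = ennreal (\<Sum>k. c k)" by (rule suminf_ennreal2) (use c in auto)
  finally have "(\<integral>\<^sup>+x. (\<Sum>k. ennreal (f k x)) \<partial>M) \<noteq> \<infinity>"
    by (auto simp: top_unique)
  then have "AE x in M. (\<Sum>k. ennreal (f k x)) \<noteq> \<infinity>"
    by (intro nn_integral_PInf_AE) measurable
  then show ?thesis
    by eventually_elim (auto intro!: summable_suminf_not_top nonneg)
qed

text \<open>Telescoping, from \<open>1 / n^2 <= 1 / (n - 1) - 1 / n\<close>.\<close>

lemma sum_inverse_squares_le:
  assumes "1 \<le> N" "N \<le> K"
  shows "(\<Sum>n\<in>{N<..K}. 1 / (real n)\<^sup>2) \<le> 1 / real N"
proof -
  have "(\<Sum>n\<in>{N<..K}. 1 / (real n)\<^sup>2) \<le> 1 / real N - 1 / real K"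
    using assms(2)
  proof (induction K rule: dec_induct)
    case (step K)
    have "{N<..Suc K} = insert (Suc K) {N<..K}" using step by auto
    then have "(\<Sum>n\<in>{N<..Suc K}. 1 / (real n)\<^sup>2) \<le> 1 / (real (Suc K))\<^sup>2 + (1 / real N - 1 / real K)"
      using step by simp
    moreover have "1 / (real (Suc K))\<^sup>2 \<le> 1 / real K - 1 / real (Suc K)"
    proof -
      have K: "real K > 0" using step assms(1) by simp
      then have "1 / (real (Suc K))\<^sup>2 \<le> 1 / (real K * real (Suc K))"
        by (intro divide_left_mono) (auto simp: power2_eq_square)
      also have "\<dots> = 1 / real K - 1 / real (Suc K)" using K by (simp add: field_simps)
      finally show ?thesis .
    qed
    ultimately show ?case by linarith
  qed simp
  moreover have "1 / real K \<ge> 0" by simp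
  ultimately show ?thesis by linarith
qed

text \<open>Convexity gives \<open>|a - b| (exp a + exp b)\<close>, and a weighted
  arithmetic-geometric mean inequality separates the factors. The free weight \<open>t\<close> later
  balances a small second moment against bounded exponential moments.\<close>

lemma abs_exp_diff_le:
  fixes a b t :: real
  assumes "t > 0"
  shows "\<bar>exp a - exp b\<bar> \<le> t * (a - b)\<^sup>2 + (exp (2 * a) + exp (2 * b)) / t"
proof -
  have le: "exp x - exp y \<le> (x - y) * exp x" for x y :: real
  proof -
    have "exp x * (1 + (y - x)) \<le> exp x * exp (y - x)"
      by (intro mult_left_mono exp_ge_add_one_self) auto
    then show ?thesis by (simp add: exp_add [symmetric] algebra_simps)
  qed
  have "\<bar>exp a - exp b\<bar> \<le> \<bar>a - b\<bar> * (exp a + exp b)"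
  proof (cases "a \<ge> b")
    case True
    then have "\<bar>exp a - exp b\<bar> \<le> (a - b) * exp a" using le[of a b] by simp
    also have "\<dots> \<le> \<bar>a - b\<bar> * (exp a + exp b)" by (intro mult_mono) auto
    finally show ?thesis .
  next
    case False
    then have "\<bar>exp a - exp b\<bar> \<le> (b - a) * exp b" using le[of b a] by simp
    also have "\<dots> \<le> \<bar>a - b\<bar> * (exp a + exp b)" using False by (intro mult_mono) auto
    finally show ?thesis .
  qed
  also have "\<dots> \<le> t * (a - b)\<^sup>2 / 2 + (exp a + exp b)\<^sup>2 / (2 * t)"
  proof -
    have "0 \<le> (t * \<bar>a - b\<bar> - (exp a + exp b))\<^sup>2" by simp
    then have "2 * t * (\<bar>a - b\<bar> * (exp a + exp b)) \<le> t\<^sup>2 * (a - b)\<^sup>2 + (exp a + exp b)\<^sup>2"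
      by (simp add: power2_diff power_mult_distrib algebra_simps)
    then have "(2 * t * (\<bar>a - b\<bar> * (exp a + exp b))) / (2 * t) \<le> (t\<^sup>2 * (a - b)\<^sup>2 + (exp a + exp b)\<^sup>2) / (2 * t)"
      using assms by (intro divide_right_mono) auto
    then show ?thesis using assms by (simp add: add_divide_distrib power2_eq_square)
  qed
  also have "\<dots> \<le> t * (a - b)\<^sup>2 + (exp (2 * a) + exp (2 * b)) / t"
  proof (rule add_mono)
    define X where "X = exp (2 * a) + exp (2 * b)"
    have "0 \<le> (exp a - exp b)\<^sup>2" by simp
    then have "(exp a + exp b)\<^sup>2 \<le> 2 * X"
      by (simp add: X_def power2_sum power2_diff exp_double)
    then have "(exp a + exp b)\<^sup>2 / (2 * t) \<le> 2 * X / (2 * t)"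
      using assms by (intro divide_right_mono) auto
    then show "(exp a + exp b)\<^sup>2 / (2 * t) \<le> X / t" by simp
  qed (use assms in auto)
  finally show ?thesis .
qed

locale sech_sequence = prob_space M for M :: "'a measure" +
  fixes A :: "nat \<Rightarrow> 'a \<Rightarrow> real"
  assumes density: "\<And>n. n \<ge> 1 \<Longrightarrow> distributed M lborel (A n) (\<lambda>x. ennreal (1 / pi * (1 / cosh x)))"
    and indep: "indep_vars (\<lambda>_. borel) A {1..}"
begin

section \<open>Generating functions and moments of the increments\<close>

definition partial_sum :: "nat \<Rightarrow> 'a \<Rightarrow> real" where
  "partial_sum N \<omega> = 4 / pi\<^sup>2 * (\<Sum>n=1..N. 1 / real n * A n \<omega>)"

lemma measurable_A: "n \<ge> 1 \<Longrightarrow> A n \<in> borel_measurable M"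
  using distributed_measurable[OF density] by simp

lemma measurable_partial_sum [measurable]: "partial_sum N \<in> borel_measurable M"
  unfolding partial_sum_def [abs_def]
  by (intro borel_measurable_times borel_measurable_sum) (auto intro: measurable_A)

lemma mgf_A:
  assumes "n \<ge> 1" "\<bar>z\<bar> < 1"
  shows "(\<integral>\<^sup>+\<omega>. ennreal (exp (z * A n \<omega>)) \<partial>M) = ennreal (1 / cos (pi * z / 2))"
proof -
  have "(\<integral>\<^sup>+\<omega>. ennreal (exp (z * A n \<omega>)) \<partial>M) =
      (\<integral>\<^sup>+x. ennreal (1 / pi * (1 / cosh x)) * ennreal (exp (z * x)) \<partial>lborel)"
    by (rule distributed_nn_integral [symmetric, OF density]) (use assms in measurable)
  also have "\<dots> = (\<integral>\<^sup>+x. ennreal (exp (z * x) / (pi * cosh x)) \<partial>lborel)"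
    by (intro nn_integral_cong) (simp add: ennreal_mult' [symmetric])
  also have "\<dots> = ennreal (1 / cos (pi * z / 2))" by (rule sech_mgf[OF assms(2)])
  finally show ?thesis .
qed

text \<open>Independence factors the expectation. The admissible range of \<open>s\<close> grows
  with \<open>N\<close>, because only coefficients with \<open>n > N\<close> occur; this is what
  later yields decaying moments. The case \<open>N = 0\<close> covers the partial sums
  themselves.\<close>

lemma mgf_increment:
  assumes "N \<le> K" "\<bar>s\<bar> \<le> real (Suc N)"
  shows "(\<integral>\<^sup>+\<omega>. ennreal (exp (s * (partial_sum K \<omega> - partial_sum N \<omega>))) \<partial>M) =
      ennreal (\<Prod>n\<in>{N<..K}. 1 / cos (2 * s / (pi * real n)))"
proof -
  define z where "z n = 4 * s / (pi\<^sup>2 * real n)" for n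
  have z: "\<bar>z n\<bar> < 1" if "n > N" for n
  proof -
    have "pi\<^sup>2 > 2\<^sup>2" using pi_gt3 by (intro power_strict_mono) auto
    moreover have "\<bar>s\<bar> \<le> real n" "0 < real n" using that assms by auto
    ultimately have "4 * \<bar>s\<bar> < pi\<^sup>2 * real n"
      by (intro le_less_trans[of "4 * \<bar>s\<bar>" "4 * real n"] mult_strict_right_mono) auto
    then show ?thesis using \<open>0 < real n\<close> by (simp add: z_def abs_mult)
  qed
  have "{1..K} = {1..N} \<union> {N<..K}" using assms by auto
  then have "(\<Sum>n=1..K. 1 / real n * A n \<omega>) = (\<Sum>n=1..N. 1 / real n * A n \<omega>) + (\<Sum>n\<in>{N<..K}. 1 / real n * A n \<omega>)" for \<omega>
    by (simp only:) (subst sum.union_disjoint, auto)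
  then have "s * (partial_sum K \<omega> - partial_sum N \<omega>) = s * (4 / pi\<^sup>2 * (\<Sum>n\<in>{N<..K}. 1 / real n * A n \<omega>))" for \<omega>
    by (simp add: partial_sum_def algebra_simps)
  also have "s * (4 / pi\<^sup>2 * (\<Sum>n\<in>{N<..K}. 1 / real n * A n \<omega>)) = (\<Sum>n\<in>{N<..K}. z n * A n \<omega>)" for \<omega>
    by (simp add: sum_distrib_left z_def mult_ac)
  finally have "(\<integral>\<^sup>+\<omega>. ennreal (exp (s * (partial_sum K \<omega> - partial_sum N \<omega>))) \<partial>M) =
      (\<integral>\<^sup>+\<omega>. (\<Prod>n\<in>{N<..K}. ennreal (exp (z n * A n \<omega>))) \<partial>M)"
    by (simp add: exp_sum prod_ennreal)
  also have "\<dots> = (\<Prod>n\<in>{N<..K}. \<integral>\<^sup>+\<omega>. ennreal (exp (z n * A n \<omega>)) \<partial>M)"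
  proof (rule indep_vars_nn_integral)
    have "indep_vars (\<lambda>_. borel) A {N<..K}" by (rule indep_vars_subset[OF indep]) auto
    then show "indep_vars (\<lambda>_. borel) (\<lambda>n \<omega>. ennreal (exp (z n * A n \<omega>))) {N<..K}"
      by (rule indep_vars_compose2) measurable
  qed auto
  also have "\<dots> = (\<Prod>n\<in>{N<..K}. ennreal (1 / cos (2 * s / (pi * real n))))"
  proof (rule prod.cong)
    fix n assume n: "n \<in> {N<..K}"
    have "pi * z n / 2 = 2 * s / (pi * real n)" by (simp add: z_def power2_eq_square)
    then show "(\<integral>\<^sup>+\<omega>. ennreal (exp (z n * A n \<omega>)) \<partial>M) = ennreal (1 / cos (2 * s / (pi * real n)))"
      using mgf_A[of n "z n"] z n by auto
  qed simp
  also have "\<dots> = ennreal (\<Prod>n\<in>{N<..K}. 1 / cos (2 * s / (pi * real n)))"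
  proof (rule prod_ennreal)
    fix n assume n: "n \<in> {N<..K}"
    have "pi * z n / 2 = 2 * s / (pi * real n)" by (simp add: z_def power2_eq_square)
    moreover have "\<bar>pi * z n / 2\<bar> < pi / 2"
      using z[of n] n by (simp add: abs_mult)
    ultimately have "\<bar>2 * s / (pi * real n)\<bar> < pi / 2" by (simp only:)
    then have "cos (2 * s / (pi * real n)) > 0" by (intro cos_gt_zero_pi) linarith+
    then show "0 \<le> 1 / cos (2 * s / (pi * real n))" by simp
  qed
  finally show ?thesis .
qed

text \<open>A sub-Gaussian bound: each secant has argument of modulus at most
  \<open>|s| / n <= 1\<close>, so \<open>sec_le_exp\<close> bounds it by
  \<open>exp (s^2 / n^2)\<close>.\<close>

lemma mgf_increment_le:
  assumes "N \<le> K" "\<bar>s\<bar> \<le> real (Suc N)" "(\<Sum>n\<in>{N<..K}. 1 / (real n)\<^sup>2) \<le> c"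
  shows "(\<integral>\<^sup>+\<omega>. ennreal (exp (s * (partial_sum K \<omega> - partial_sum N \<omega>))) \<partial>M) \<le> ennreal (exp (s\<^sup>2 * c))"
proof -
  have y: "\<bar>2 * s / (pi * real n)\<bar> \<le> 1" "(2 * s / (pi * real n))\<^sup>2 \<le> s\<^sup>2 * (1 / (real n)\<^sup>2)" if "n > N" for n
  proof -
    have n: "\<bar>s\<bar> \<le> real n" "real n > 0" using that assms by auto
    have "\<bar>2 * s / (pi * real n)\<bar> = 2 / pi * (\<bar>s\<bar> / real n)" by (simp add: abs_mult)
    also have "\<dots> \<le> 1 * (\<bar>s\<bar> / real n)"
      using pi_gt3 by (intro mult_right_mono) auto
    finally have le: "\<bar>2 * s / (pi * real n)\<bar> \<le> \<bar>s / real n\<bar>" by simp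
    also have "\<dots> \<le> 1" using n by simp
    finally show "\<bar>2 * s / (pi * real n)\<bar> \<le> 1" .
    show "(2 * s / (pi * real n))\<^sup>2 \<le> s\<^sup>2 * (1 / (real n)\<^sup>2)"
      using le unfolding abs_le_square_iff by (simp add: power_divide)
  qed
  have "(\<Prod>n\<in>{N<..K}. 1 / cos (2 * s / (pi * real n))) \<le> (\<Prod>n\<in>{N<..K}. exp (s\<^sup>2 * (1 / (real n)\<^sup>2)))"
  proof (intro prod_mono conjI)
    fix n assume "n \<in> {N<..K}"
    then have n: "n > N" by simp
    show "0 \<le> 1 / cos (2 * s / (pi * real n))"
      using sec_le_exp(1)[OF y(1)[OF n]] by simp
    have "1 / cos (2 * s / (pi * real n)) \<le> exp ((2 * s / (pi * real n))\<^sup>2)"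
      by (rule sec_le_exp(2)[OF y(1)[OF n]])
    also have "\<dots> \<le> exp (s\<^sup>2 * (1 / (real n)\<^sup>2))"
      unfolding exp_le_cancel_iff by (rule y(2)[OF n])
    finally show "1 / cos (2 * s / (pi * real n)) \<le> exp (s\<^sup>2 * (1 / (real n)\<^sup>2))" .
  qed
  also have "\<dots> = exp (s\<^sup>2 * (\<Sum>n\<in>{N<..K}. 1 / (real n)\<^sup>2))"
    by (simp only: exp_sum [symmetric] sum_distrib_left finite_greaterThanAtMost)
  also have "\<dots> \<le> exp (s\<^sup>2 * c)"
    using assms(3) by (simp add: mult_left_mono)
  finally show ?thesis
    by (subst mgf_increment[OF assms(1,2)]) (rule ennreal_leI)
qed

text \<open>At \<open>s = t\<close> and \<open>s = - t\<close> with \<open>t = sqrt N\<close>, the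
  sub-Gaussian bound is the constant \<open>exp 1\<close>. These two exponentials dominate
  \<open>|t T|^p / p!\<close>, and dividing by \<open>t^p\<close> gives decay of order
  \<open>N^(-p/2)\<close>.\<close>

lemma moment_increment_le:
  assumes "1 \<le> N" "N \<le> K"
  shows "(\<integral>\<^sup>+\<omega>. ennreal (\<bar>partial_sum K \<omega> - partial_sum N \<omega>\<bar> ^ p) \<partial>M) \<le> ennreal (2 * exp 1 * fact p / sqrt (real N) ^ p)"
proof -
  define T where "T \<omega> = partial_sum K \<omega> - partial_sum N \<omega>" for \<omega>
  have [measurable]: "T \<in> borel_measurable M" unfolding T_def [abs_def] by measurable
  define t where "t = sqrt (real N)"
  have t: "t > 0" "t\<^sup>2 = real N" using assms by (auto simp: t_def)
  have "real N \<le> (real N)\<^sup>2" using assms by (simp add: power2_eq_square)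
  then have "t \<le> real N" using assms unfolding t_def by (intro real_le_lsqrt) auto
  then have bound: "(\<integral>\<^sup>+\<omega>. ennreal (exp (s * T \<omega>)) \<partial>M) \<le> ennreal (exp 1)" if "\<bar>s\<bar> = t" for s
  proof -
    have "s\<^sup>2 = real N" using that t by (metis power2_abs)
    then have one: "s\<^sup>2 * (1 / real N) = 1" using assms by simp
    have "\<bar>s\<bar> \<le> real (Suc N)" using that \<open>t \<le> real N\<close> by simp
    from mgf_increment_le[OF assms(2) this sum_inverse_squares_le[OF assms]]
    show ?thesis unfolding T_def one .
  qed
  have "(\<integral>\<^sup>+\<omega>. ennreal (\<bar>T \<omega>\<bar> ^ p) \<partial>M) \<le>
      (\<integral>\<^sup>+\<omega>. ennreal (fact p / t ^ p) * (ennreal (exp (t * T \<omega>)) + ennreal (exp (- t * T \<omega>))) \<partial>M)"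
  proof (rule nn_integral_mono)
    fix \<omega>
    have "\<bar>t * T \<omega>\<bar> ^ p \<le> fact p * (exp (t * T \<omega>) + exp (- t * T \<omega>))"
      using abs_power_le_exp[of "t * T \<omega>" p] by simp
    then have "\<bar>T \<omega>\<bar> ^ p \<le> fact p / t ^ p * (exp (t * T \<omega>) + exp (- t * T \<omega>))"
      using t by (simp add: abs_mult power_mult_distrib field_simps)
    then show "ennreal (\<bar>T \<omega>\<bar> ^ p) \<le> ennreal (fact p / t ^ p) * (ennreal (exp (t * T \<omega>)) + ennreal (exp (- t * T \<omega>)))"
      using t by (subst ennreal_plus [symmetric] | subst ennreal_mult' [symmetric] | simp add: ennreal_leI)+
  qed
  also have "\<dots> = ennreal (fact p / t ^ p) * ((\<integral>\<^sup>+\<omega>. ennreal (exp (t * T \<omega>)) \<partial>M) + (\<integral>\<^sup>+\<omega>. ennreal (exp (- t * T \<omega>)) \<partial>M))"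
    by (subst nn_integral_cmult, measurable, subst nn_integral_add, measurable)
  also have "\<dots> \<le> ennreal (fact p / t ^ p) * (ennreal (exp 1) + ennreal (exp 1))"
    using t by (intro mult_left_mono add_mono bound) auto
  also have "\<dots> = ennreal (fact p / t ^ p * (exp 1 + exp 1))"
    using t by (subst ennreal_mult', simp, subst ennreal_plus) auto
  also have "fact p / t ^ p * (exp 1 + exp 1) = 2 * exp 1 * fact p / t ^ p"
    by simp
  finally show ?thesis by (simp only: T_def t_def)
qed

text \<open>
  Along \<open>N = 4\<^sup>k\<close> the first absolute moments of the increments are already summable, so this limit exists
  almost surely.
\<close>

definition series_limit :: "'a \<Rightarrow> real" where
  "series_limit \<omega> = lim (\<lambda>k. partial_sum (4 ^ k) \<omega>)"

lemma measurable_series_limit [measurable]: "series_limit \<in> borel_measurable M"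
  unfolding series_limit_def [abs_def] by measurable

section \<open>Almost sure convergence\<close>

lemma AE_subsequence_tendsto: "AE \<omega> in M. (\<lambda>k. partial_sum (4 ^ k) \<omega>) \<longlonglongrightarrow> series_limit \<omega>"
proof -
  define d where "d k \<omega> = partial_sum (4 ^ Suc k) \<omega> - partial_sum (4 ^ k) \<omega>" for k \<omega>
  have "AE \<omega> in M. summable (\<lambda>k. \<bar>d k \<omega>\<bar>)"
  proof (rule AE_summable_of_nn_integral_le)
    show "(\<lambda>\<omega>. \<bar>d k \<omega>\<bar>) \<in> borel_measurable M" for k
      unfolding d_def by measurable
    show "summable (\<lambda>k. 2 * exp 1 * (1 / 2) ^ k :: real)"
      by (intro summable_mult summable_geometric) simp
    show "(\<integral>\<^sup>+\<omega>. ennreal \<bar>d k \<omega>\<bar> \<partial>M) \<le> ennreal (2 * exp 1 * (1 / 2) ^ k)" for k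
    proof -
      \<comment> \<open>Hence the first-moment bound along powers of 4 is geometric.\<close>
      have "sqrt (real (4 ^ k)) = 2 ^ k" by (simp add: real_sqrt_power)
      then show ?thesis
        using moment_increment_le[of "4 ^ k" "4 ^ Suc k" 1]
        by (simp add: d_def power_divide)
    qed
  qed auto
  then show ?thesis
  proof eventually_elim
    case (elim \<omega>)
    then have "summable (\<lambda>k. d k \<omega>)" by (rule summable_rabs_cancel)
    then obtain l where "(\<lambda>n. \<Sum>k<n. d k \<omega>) \<longlonglongrightarrow> l" by (auto simp: summable_def sums_def)
    moreover have "(\<Sum>k<n. d k \<omega>) = partial_sum (4 ^ n) \<omega> - partial_sum (4 ^ 0) \<omega>" for n
      unfolding d_def by (rule sum_lessThan_telescope)
    ultimately have "(\<lambda>n. (partial_sum (4 ^ n) \<omega> - partial_sum (4 ^ 0) \<omega>) + partial_sum (4 ^ 0) \<omega>) \<longlonglongrightarrow> l + partial_sum (4 ^ 0) \<omega>"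
      by (intro tendsto_add tendsto_const) simp
    then have "convergent (\<lambda>n. partial_sum (4 ^ n) \<omega>)" by (auto simp: convergent_def)
    then show ?case unfolding series_limit_def by (simp add: convergent_LIMSEQ_iff)
  qed
qed

lemma eventually_power_ge: "eventually (\<lambda>k. N \<le> (4 :: nat) ^ k) sequentially"
proof -
  have "N \<le> 4 ^ k" if "k \<ge> N" for k :: nat
    using that less_exp[of k] power_mono[of 2 "4 :: nat" k] by linarith
  then show ?thesis by (auto simp: eventually_sequentially)
qed

text \<open>Fatou's lemma along \<open>K = 4^k\<close>, since the increment bound does not depend on
  \<open>K\<close>.\<close>

lemma moment_tail_le:
  assumes "1 \<le> N"
  shows "(\<integral>\<^sup>+\<omega>. ennreal (\<bar>series_limit \<omega> - partial_sum N \<omega>\<bar> ^ p) \<partial>M) \<le> ennreal (2 * exp 1 * fact p / sqrt (real N) ^ p)"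
proof (rule nn_integral_le_of_AE_tendsto)
  show "AE \<omega> in M. (\<lambda>k. \<bar>partial_sum (4 ^ k) \<omega> - partial_sum N \<omega>\<bar> ^ p) \<longlonglongrightarrow> \<bar>series_limit \<omega> - partial_sum N \<omega>\<bar> ^ p"
    using AE_subsequence_tendsto by eventually_elim (intro tendsto_intros)
  show "eventually (\<lambda>k. (\<integral>\<^sup>+\<omega>. ennreal (\<bar>partial_sum (4 ^ k) \<omega> - partial_sum N \<omega>\<bar> ^ p) \<partial>M)
      \<le> ennreal (2 * exp 1 * fact p / sqrt (real N) ^ p)) sequentially"
    using eventually_power_ge[of N] by eventually_elim (rule moment_increment_le[OF assms])
qed measurable

text \<open>The fourth moment of the deviation from the limit is of order \<open>1 / N^2\<close>,
  which is summable; the second moment bound would give only \<open>1 / N\<close>. Summable fourth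
  powers tend to 0 almost surely.\<close>

lemma AE_partial_sum_tendsto: "AE \<omega> in M. (\<lambda>N. partial_sum N \<omega>) \<longlonglongrightarrow> series_limit \<omega>"
proof -
  have "AE \<omega> in M. summable (\<lambda>N. \<bar>series_limit \<omega> - partial_sum (Suc N) \<omega>\<bar> ^ 4)"
  proof (rule AE_summable_of_nn_integral_le)
    show "(\<lambda>\<omega>. \<bar>series_limit \<omega> - partial_sum (Suc N) \<omega>\<bar> ^ 4) \<in> borel_measurable M" for N
      by measurable
    \<comment> \<open>The constant is \<open>2 * fact 4\<close>; the shift to \<open>Suc N\<close>
      respects the requirement \<open>N >= 1\<close> of the tail bound.\<close>
    have "summable (\<lambda>N. 48 * exp 1 * (1 / real (Suc N) ^ 2))"
      using zeta_nat_sums[of 2] by (intro summable_mult) (simp add: sums_iff)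
    then show "summable (\<lambda>N. 48 * exp 1 / (real (Suc N))\<^sup>2)" by simp
    show "(\<integral>\<^sup>+\<omega>. ennreal (\<bar>series_limit \<omega> - partial_sum (Suc N) \<omega>\<bar> ^ 4) \<partial>M) \<le> ennreal (48 * exp 1 / (real (Suc N))\<^sup>2)" for N
    proof -
      have "sqrt (real (Suc N)) ^ 4 = (sqrt (real (Suc N)) ^ 2) ^ 2" by (simp only: power_mult [symmetric]) simp
      then have "sqrt (real (Suc N)) ^ 4 = (real (Suc N))\<^sup>2" by simp
      then show ?thesis
        using moment_tail_le[of "Suc N" 4] by (simp add: fact_numeral mult.commute)
    qed
  qed auto
  then show ?thesis
  proof eventually_elim
    case (elim \<omega>)
    then have "(\<lambda>N. root 4 (\<bar>series_limit \<omega> - partial_sum (Suc N) \<omega>\<bar> ^ 4)) \<longlonglongrightarrow> root 4 0"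
      by (intro tendsto_real_root summable_LIMSEQ_zero)
    moreover have "root 4 (\<bar>x\<bar> ^ 4) = \<bar>x\<bar>" for x :: real
      by (rule real_root_power_cancel) auto
    ultimately have "(\<lambda>N. series_limit \<omega> - partial_sum (Suc N) \<omega>) \<longlonglongrightarrow> 0"
      by (simp only: tendsto_rabs_zero_iff real_root_zero)
    then have "(\<lambda>N. series_limit \<omega> - (series_limit \<omega> - partial_sum (Suc N) \<omega>)) \<longlonglongrightarrow> series_limit \<omega> - 0"
      by (intro tendsto_diff tendsto_const)
    then have "(\<lambda>N. partial_sum (Suc N) \<omega>) \<longlonglongrightarrow> series_limit \<omega>" by simp
    then show ?case by (rule LIMSEQ_imp_Suc)
  qed
qed

section \<open>Passage to the limit in the generating function\<close>

lemma mgf_partial_sum_le: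
  assumes "\<bar>s\<bar> \<le> 1"
  shows "(\<integral>\<^sup>+\<omega>. ennreal (exp (s * partial_sum N \<omega>)) \<partial>M) \<le> ennreal (exp 2)"
proof -
  \<comment> \<open>The term \<open>n = 1\<close> is split off, since the telescoping bound starts
    at \<open>N = 1\<close>; each part contributes at most 1.\<close>
  have "(\<Sum>n\<in>{0<..N}. 1 / (real n)\<^sup>2) \<le> 2"
  proof (cases "N = 0")
    case False
    then have "{0<..N} = insert 1 {1<..N}" by auto
    then show ?thesis using sum_inverse_squares_le[of 1 N] False by simp
  qed simp
  from mgf_increment_le[OF _ _ this, of s] assms
  have "(\<integral>\<^sup>+\<omega>. ennreal (exp (s * partial_sum N \<omega>)) \<partial>M) \<le> ennreal (exp (s\<^sup>2 * 2))"
    by (simp add: partial_sum_def)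
  also have "\<dots> \<le> ennreal (exp 2)"
    using assms by (intro ennreal_leI) (simp add: abs_square_le_1)
  finally show ?thesis .
qed

lemma mgf_series_limit_le:
  assumes "\<bar>s\<bar> \<le> 1"
  shows "(\<integral>\<^sup>+\<omega>. ennreal (exp (s * series_limit \<omega>)) \<partial>M) \<le> ennreal (exp 2)"
proof (rule nn_integral_le_of_AE_tendsto)
  show "AE \<omega> in M. (\<lambda>k. exp (s * partial_sum k \<omega>)) \<longlonglongrightarrow> exp (s * series_limit \<omega>)"
    using AE_partial_sum_tendsto by eventually_elim (intro tendsto_intros)
qed (use mgf_partial_sum_le[OF assms] in auto)

lemma integrable_exp_series_limit:
  assumes "\<bar>s\<bar> \<le> 1"
  shows "integrable M (\<lambda>\<omega>. exp (s * series_limit \<omega>))"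
  by (rule integrableI_bounded) (use mgf_series_limit_le[OF assms] in \<open>auto simp: le_less_trans\<close>)

text \<open>\<open>abs_exp_diff_le\<close> with weight \<open>t = sqrt N\<close>: the second moment
  of the tail is at most \<open>4 exp 1 / N\<close>, and the exponential moments are at most
  \<open>exp 2\<close>. The exponents get doubled, which is why \<open>s\<close> is limited to
  \<open>1 / 2\<close>.\<close>

lemma exp_partial_sum_L1:
  assumes "\<bar>s\<bar> \<le> 1 / 2" "N \<ge> 1"
  shows "(\<integral>\<^sup>+\<omega>. ennreal \<bar>exp (s * partial_sum N \<omega>) - exp (s * series_limit \<omega>)\<bar> \<partial>M)
           \<le> ennreal ((4 * exp 1 + 2 * exp 2) / sqrt (real N))"
proof -
  define t where "t = sqrt (real N)"
  have t: "t > 0" using assms by (simp add: t_def)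
  have s2: "\<bar>2 * s\<bar> \<le> 1" "s\<^sup>2 \<le> 1" using assms by (auto simp: abs_square_le_1)
  have ennreal_eq: "ennreal (t * x + u * (v + w)) = ennreal t * ennreal x + ennreal u * (ennreal v + ennreal w)"
    if "t \<ge> 0" "x \<ge> 0" "u \<ge> 0" "v \<ge> 0" "w \<ge> 0" for t x u v w
    using that by (simp add: ennreal_mult' ennreal_plus)
  have "(\<integral>\<^sup>+\<omega>. ennreal \<bar>exp (s * partial_sum N \<omega>) - exp (s * series_limit \<omega>)\<bar> \<partial>M)
    \<le> (\<integral>\<^sup>+\<omega>. ennreal t * ennreal (\<bar>series_limit \<omega> - partial_sum N \<omega>\<bar> ^ 2) +
        ennreal (1 / t) * (ennreal (exp ((2 * s) * partial_sum N \<omega>)) + ennreal (exp ((2 * s) * series_limit \<omega>))) \<partial>M)"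
  proof (rule nn_integral_mono)
    fix \<omega>
    define a b where "a = partial_sum N \<omega>" and "b = series_limit \<omega>"
    have "\<bar>exp (s * a) - exp (s * b)\<bar> \<le> t * (s * a - s * b)\<^sup>2 + (exp (2 * (s * a)) + exp (2 * (s * b))) / t"
      by (rule abs_exp_diff_le[OF t])
    also have "(s * a - s * b)\<^sup>2 = s\<^sup>2 * \<bar>b - a\<bar> ^ 2" by (simp add: power2_eq_square algebra_simps)
    also have "t * (s\<^sup>2 * \<bar>b - a\<bar> ^ 2) \<le> t * (1 * \<bar>b - a\<bar> ^ 2)"
      using t s2 by (intro mult_left_mono mult_right_mono) auto
    finally have "\<bar>exp (s * a) - exp (s * b)\<bar> \<le> t * \<bar>b - a\<bar> ^ 2 + 1 / t * (exp ((2 * s) * a) + exp ((2 * s) * b))"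
      by (simp add: mult.assoc)
    then have "ennreal \<bar>exp (s * a) - exp (s * b)\<bar> \<le> ennreal (t * \<bar>b - a\<bar> ^ 2 + 1 / t * (exp ((2 * s) * a) + exp ((2 * s) * b)))"
      by (rule ennreal_leI)
    also have "\<dots> = ennreal t * ennreal (\<bar>b - a\<bar> ^ 2) + ennreal (1 / t) * (ennreal (exp ((2 * s) * a)) + ennreal (exp ((2 * s) * b)))"
      using t by (intro ennreal_eq) auto
    finally show "ennreal \<bar>exp (s * partial_sum N \<omega>) - exp (s * series_limit \<omega>)\<bar> \<le> ennreal t * ennreal (\<bar>series_limit \<omega> - partial_sum N \<omega>\<bar> ^ 2) +
        ennreal (1 / t) * (ennreal (exp ((2 * s) * partial_sum N \<omega>)) + ennreal (exp ((2 * s) * series_limit \<omega>)))"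
      by (simp only: a_def b_def)
  qed
  also have "\<dots> = ennreal t * (\<integral>\<^sup>+\<omega>. ennreal (\<bar>series_limit \<omega> - partial_sum N \<omega>\<bar> ^ 2) \<partial>M) +
        ennreal (1 / t) * ((\<integral>\<^sup>+\<omega>. ennreal (exp ((2 * s) * partial_sum N \<omega>)) \<partial>M) + (\<integral>\<^sup>+\<omega>. ennreal (exp ((2 * s) * series_limit \<omega>)) \<partial>M))"
    by (simp add: nn_integral_add nn_integral_cmult)
  also have "\<dots> \<le> ennreal t * ennreal (2 * exp 1 * fact 2 / sqrt (real N) ^ 2) + ennreal (1 / t) * (ennreal (exp 2) + ennreal (exp 2))"
    by (intro add_mono mult_left_mono moment_tail_le mgf_partial_sum_le mgf_series_limit_le s2 assms) auto
  also have "\<dots> = ennreal (t * (2 * exp 1 * fact 2 / t ^ 2) + 1 / t * (exp 2 + exp 2))"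
    using t by (subst ennreal_eq) (auto simp: t_def)
  also have "t * (2 * exp 1 * fact 2 / t ^ 2) + 1 / t * (exp 2 + exp 2) = (4 * exp 1 + 2 * exp 2) / t"
    using t by (simp add: field_simps power2_eq_square)
  finally show ?thesis by (simp only: t_def)
qed

text \<open>Both sides are limits of the generating functions of the partial sums: the left by
  convergence in the mean, the right because these are finite secant products, whose logarithms
  converge by \<open>cos_prod_sums\<close>.\<close>

lemma mgf_series_limit:
  assumes s: "\<bar>s\<bar> \<le> 1 / 2"
  shows "(\<integral>\<omega>. exp (s * series_limit \<omega>) \<partial>M) = exp (\<Sum>m. writhe_coeff (Suc m) / real (Suc m) * s ^ Suc m)"
proof (rule LIMSEQ_unique)
  have pos: "cos (2 * s / (pi * real n)) > 0" if "n \<ge> 1" for n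
  proof -
    have "\<bar>2 * s\<bar> \<le> 1" using s by auto
    also have "1 \<le> pi * real n" using pi_gt3 that mult_mono[of 1 pi 1 "real n"] by auto
    finally have "\<bar>2 * s\<bar> \<le> pi * real n" .
    then show ?thesis using that by (intro sec_le_exp) (auto simp: abs_mult)
  qed
  have int: "(\<integral>\<^sup>+\<omega>. ennreal (exp (s * partial_sum N \<omega>)) \<partial>M) = ennreal (\<Prod>n\<in>{0<..N}. 1 / cos (2 * s / (pi * real n)))" for N
    using mgf_increment[of 0 N s] s by (simp add: partial_sum_def)
  have nonneg: "(\<Prod>n\<in>{0<..N}. 1 / cos (2 * s / (pi * real n))) \<ge> 0" for N
    using pos by (intro prod_nonneg) (simp add: less_imp_le)
  have has_int: "integrable M (\<lambda>\<omega>. exp (s * partial_sum N \<omega>))" for N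
    by (rule integrableI_nn_integral_finite[OF _ _ int]) auto
  have val: "(\<integral>\<omega>. exp (s * partial_sum N \<omega>) \<partial>M) = (\<Prod>n\<in>{0<..N}. 1 / cos (2 * s / (pi * real n)))" for N
    by (subst integral_eq_nn_integral) (auto simp: int nonneg)
  show "(\<lambda>N. \<integral>\<omega>. exp (s * partial_sum N \<omega>) \<partial>M) \<longlonglongrightarrow> (\<integral>\<omega>. exp (s * series_limit \<omega>) \<partial>M)"
  proof (rule tendsto_L1_int[OF has_int])
    show "integrable M (\<lambda>\<omega>. exp (s * series_limit \<omega>))"
      using s by (intro integrable_exp_series_limit) auto
    have "(\<lambda>N. (4 * exp 1 + 2 * exp 2) / sqrt (real N)) \<longlonglongrightarrow> 0"
      by (intro tendsto_divide_0[OF tendsto_const] filterlim_at_top_imp_at_infinity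
          filterlim_compose[OF sqrt_at_top] filterlim_real_sequentially)
    then have lim: "(\<lambda>N. ennreal ((4 * exp 1 + 2 * exp 2) / sqrt (real N))) \<longlonglongrightarrow> 0"
      using tendsto_ennrealI by fastforce
    show "(\<lambda>N. \<integral>\<^sup>+\<omega>. ennreal (norm (exp (s * partial_sum N \<omega>) - exp (s * series_limit \<omega>))) \<partial>M) \<longlonglongrightarrow> 0"
    proof (rule tendsto_sandwich[OF _ _ tendsto_const lim])
      show "eventually (\<lambda>N. (\<integral>\<^sup>+\<omega>. ennreal (norm (exp (s * partial_sum N \<omega>) - exp (s * series_limit \<omega>))) \<partial>M)
          \<le> ennreal ((4 * exp 1 + 2 * exp 2) / sqrt (real N))) sequentially"
        using eventually_ge_at_top[of 1] by eventually_elim (use exp_partial_sum_L1[OF s] in simp)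
    qed simp
  qed
  have "(\<lambda>N. exp (\<Sum>n<N. - ln (cos (2 * s / (pi * real (Suc n)))))) \<longlonglongrightarrow>
      exp (\<Sum>m. writhe_coeff (Suc m) / real (Suc m) * s ^ Suc m)"
    using cos_prod_sums[of s] s unfolding sums_def by (intro tendsto_exp) auto
  also have "(\<lambda>N. exp (\<Sum>n<N. - ln (cos (2 * s / (pi * real (Suc n)))))) = (\<lambda>N. \<integral>\<omega>. exp (s * partial_sum N \<omega>) \<partial>M)"
  proof
    fix N
    have "exp (\<Sum>n<N. - ln (cos (2 * s / (pi * real (Suc n))))) = (\<Prod>n<N. 1 / cos (2 * s / (pi * real (Suc n))))"
      unfolding exp_sum[OF finite_lessThan]
      by (intro prod.cong refl) (subst exp_minus, subst exp_ln, use pos in \<open>auto simp: inverse_eq_divide simp del: of_nat_Suc\<close>)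
    also have "\<dots> = (\<Prod>n\<in>{0<..N}. 1 / cos (2 * s / (pi * real n)))"
      by (rule prod.reindex_bij_witness[of _ "\<lambda>n. n - 1" Suc]) auto
    finally show "exp (\<Sum>n<N. - ln (cos (2 * s / (pi * real (Suc n))))) = (\<integral>\<omega>. exp (s * partial_sum N \<omega>) \<partial>M)"
      by (simp only: val)
  qed
  finally show "(\<lambda>N. \<integral>\<omega>. exp (s * partial_sum N \<omega>) \<partial>M) \<longlonglongrightarrow> exp (\<Sum>m. writhe_coeff (Suc m) / real (Suc m) * s ^ Suc m)" .
qed

end

section \<open>Identification of the law of the series\<close>

theorem mainTheorem4:
  fixes W :: "real measure"
    and M :: "'a measure"
    and A :: "nat \<Rightarrow> 'a \<Rightarrow> real"
  assumes W_distribution: "real_distribution W"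
    and W_limit: "weak_conv_m normalized_writhe_law W"
    and W_mgf: "\<forall>\<^sub>F z in nhds (0::real).
          integrable W (\<lambda>x. exp (x * z)) \<and>
          (\<integral>x. exp (x * z) \<partial>W) = exp (\<Sum>m. writhe_coeff (Suc m) / real (Suc m) * z ^ Suc m)"
    and M_prob: "prob_space M"
    and A_density: "\<And>n. n \<ge> 1 \<Longrightarrow> distributed M lborel (A n) (\<lambda>x. ennreal (1 / pi * (1 / cosh x)))"
    and A_indep: "prob_space.indep_vars M (\<lambda>_. borel) A {1..}"
  shows "\<exists>S \<in> borel_measurable M.
          (AE \<omega> in M. (\<lambda>N. 4 / pi\<^sup>2 * (\<Sum>n=1..N. 1 / real n * A n \<omega>)) \<longlonglongrightarrow> S \<omega>) \<and>
          distr M borel S = W"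
proof -
  interpret prob_space M by fact
  interpret sech_sequence M A
    by unfold_locales (fact A_density A_indep)+
  from W_mgf obtain e where e: "e > 0" "\<And>z. \<bar>z\<bar> < e \<Longrightarrow> integrable W (\<lambda>x. exp (x * z)) \<and>
      (\<integral>x. exp (x * z) \<partial>W) = exp (\<Sum>m. writhe_coeff (Suc m) / real (Suc m) * z ^ Suc m)"
    unfolding eventually_nhds_metric by auto
  have "distr M borel series_limit = W"
  proof (rule mgf_determines_distribution)
    show "real_distribution (distr M borel series_limit)"
      by (rule real_distribution_distr) simp
    \<comment> \<open>The common range: \<open>e\<close> is the radius on which the generating
      function of \<open>W\<close> is known, \<open>1 / 2\<close> the one for the series.\<close>
    show "min e (1 / 2) > 0" using e by simp
    fix s :: real assume s: "\<bar>s\<bar> < min e (1 / 2)"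
    show "integrable (distr M borel series_limit) (\<lambda>x. exp (x * s))"
      using integrable_exp_series_limit[of s] s by (subst integrable_distr_eq) (auto simp: mult.commute)
    show "integrable W (\<lambda>x. exp (x * s))" using e s by simp
    have "(\<integral>x. exp (x * s) \<partial>distr M borel series_limit) = (\<integral>\<omega>. exp (s * series_limit \<omega>) \<partial>M)"
      by (subst integral_distr) (auto simp: mult.commute)
    then show "(\<integral>x. exp (x * s) \<partial>distr M borel series_limit) = (\<integral>x. exp (x * s) \<partial>W)"
      using mgf_series_limit[of s] e(2)[of s] s by simp
  qed fact
  moreover have "AE \<omega> in M. (\<lambda>N. 4 / pi\<^sup>2 * (\<Sum>n=1..N. 1 / real n * A n \<omega>)) \<longlonglongrightarrow> series_limit \<omega>"
    using AE_partial_sum_tendsto by (simp only: partial_sum_def)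
  ultimately show ?thesis
    by (intro bexI[of _ series_limit]) auto
qed

end
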